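(* Let $X$ be an indeterminate, $G$ a matrix of rank $r$ with column set $E$, and $\mathbb{A}$ of order $q$, in the setting described in the context. For each integer $k$ let $\mathcal{M}_{1,-1}(k,\infty)$ be the set of pairs $(f,g)$ of functions $f,g:E\to\mathbb{A}$ such that $f-g$ is a flow of $G$ over $\mathbb{A}$ and $|\mathrm{supp}(f)|-|\mathrm{supp}(g)|=k$. Then, as Laurent polynomials (rational functions) in $X$, $$\sum_{k\in\mathbb{Z}}|\mathcal{M}_{1,-1}(k,\infty)|X^k = (2-X-X^{-1})^r(X-2+X^{-1}+q)^{|E|-r}\,R\!\left(M(G);\frac{q(X-2+X^{-1}+q)}{2-X-X^{-1}},\frac{2-X-X^{-1}}{X-2+X^{-1}+q}\right).$$
   Context: Setting (the paper's hypothesis "$G$ is a totally-$\mathbb{P}$ matrix and $\mathbb{A}$ a $\mathbb{P}$-module of order $q$", read as the following cases): either (i) $G$ is the vertex–edge or cycle–edge matrix of a graph with edge set $E$, or a totally unimodular matrix, and $\mathbb{A}$ is an Abelian group of order $q$; or (ii) $G$ is a matrix over $\mathrm{GF}(p^s)$, $\mathbb{A}=\mathrm{GF}(p^s)^d$, $q=p^{sd}$. With $H$ a matrix orthogonally dual to $G$ (same columns, rows of $H$ orthogonal to rows of $G$, ranks summing to $|E|$; integer in case (i)), a flow of $G$ over $\mathbb{A}$ is $h:E\to\mathbb{A}$ with $Hh^T=0$ (equivalently an $\mathbb{A}$-combination of rows of $G$). $\mathrm{supp}(f)=\{e: f(e)\ne0\}$. $M(G)$ is the matroid on $E$ of linear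 dependence of the columns of $G$, rank function $\mathrm{rk}$, rank $r$; $R(M;\lambda,x)=\sum_{B\subseteq E}\lambda^{r-\mathrm{rk}(B)}x^{|B|-\mathrm{rk}(B)}$. *)

theory Defs
  imports
    "HOL-Analysis.Finite_Cartesian_Product"
    "HOL-Library.Groups_Big_Fun"
    "HOL-Library.FuncSet"
    "HOL-Computational_Algebra.Fraction_Field"
    "HOL-Computational_Algebra.Polynomial"
    "HOL-Computational_Algebra.Primes"
    "Jordan_Normal_Form.Determinant"
    "Graph_Theory.Arc_Walk"
begin

text \<open>
  A matrix is a function \<open>G :: 'm \<Rightarrow> 'e \<Rightarrow> 'k\<close> considered on a finite row set \<open>R\<close> and
  a finite column set \<open>E\<close>; both sets may be empty (forests have no cycles, for example).
\<close>

text \<open>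
  The columns indexed by \<open>B\<close> are treated as a family, so that equal columns are dependent.
  For integer matrices the coefficients are integers; clearing denominators, this is linear
  dependence over the rationals.
\<close>
definition cols_indep :: "'m set \<Rightarrow> ('m \<Rightarrow> 'e \<Rightarrow> 'k::idom) \<Rightarrow> 'e set \<Rightarrow> bool" where
  "cols_indep R G B \<longleftrightarrow>
     (\<forall>c. (\<forall>i\<in>R. (\<Sum>e\<in>B. c e * G i e) = 0) \<longrightarrow> (\<forall>e\<in>B. c e = 0))"

text \<open>
  The rank function of the column matroid \<open>M(G)\<close>; the rank of the matrix itself is
  \<open>col_rank R G E\<close>.
\<close>
definition col_rank :: "'m set \<Rightarrow> ('m \<Rightarrow> 'e \<Rightarrow> 'k::idom) \<Rightarrow> 'e set \<Rightarrow> nat" where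
  "col_rank R G B = Max (card ` {I. I \<subseteq> B \<and> cols_indep R G I})"

definition rank_poly :: "'e set \<Rightarrow> ('e set \<Rightarrow> nat) \<Rightarrow> 'b::comm_semiring_1 \<Rightarrow> 'b \<Rightarrow> 'b" where
  "rank_poly E rk l x = (\<Sum>B\<in>Pow E. l ^ (rk E - rk B) * x ^ (card B - rk B))"

definition orth_dual ::
    "'e set \<Rightarrow> 'm set \<Rightarrow> ('m \<Rightarrow> 'e \<Rightarrow> 'k::idom) \<Rightarrow> 'n set \<Rightarrow> ('n \<Rightarrow> 'e \<Rightarrow> 'k) \<Rightarrow> bool" where
  "orth_dual E R G S H \<longleftrightarrow>
     finite S \<and>
     (\<forall>i\<in>R. \<forall>j\<in>S. (\<Sum>e\<in>E. G i e * H j e) = 0) \<and>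
     col_rank R G E + col_rank S H E = card E"

text \<open>
  The scalar action \<open>smul\<close> of the ring of matrix entries on the value group is explicit because
  there is no type class for modules over an arbitrary ring.

  A flow is annihilated by every orthogonally dual matrix \<open>H\<close> (rows numbered from 0).  Over a
  field all such \<open>H\<close> have the same kernel.  Over the integers a single arbitrary \<open>H\<close> would not
  determine the flows: \<open>H\<close> and \<open>2H\<close> are both orthogonally dual to \<open>G\<close>, but \<open>2H\<close> annihilates
  everything when \<open>2a = 0\<close> for all \<open>a\<close> in the value group.  The smallest kernel, obtained from an
  \<open>H\<close> whose rows generate all integer vectors orthogonal to the rows of \<open>G\<close> (such as a totally
  unimodular dual, or the cycle-edge matrix for a vertex-edge matrix and vice versa), is the
  intended one; it is the set of combinations of rows of \<open>G\<close> with coefficients in the group.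
\<close>
definition is_flow ::
    "('k::idom \<Rightarrow> 'a::ab_group_add \<Rightarrow> 'a) \<Rightarrow> 'e set \<Rightarrow> 'm set \<Rightarrow> ('m \<Rightarrow> 'e \<Rightarrow> 'k) \<Rightarrow> ('e \<Rightarrow> 'a) \<Rightarrow> bool"
  where
  "is_flow smul E R G h \<longleftrightarrow>
     (\<forall>(m::nat) (H :: nat \<Rightarrow> 'e \<Rightarrow> 'k). orth_dual E R G {..<m} H \<longrightarrow>
        (\<forall>j<m. (\<Sum>e\<in>E. smul (H j e) (h e)) = 0))"

definition supp :: "'e set \<Rightarrow> ('e \<Rightarrow> 'a::zero) \<Rightarrow> 'e set" where
  "supp E f = {e\<in>E. f e \<noteq> 0}"

text \<open>The set \<open>M\<^sub>1\<^sub>,\<^sub>-\<^sub>1(k,\<infinity>)\<close>; functions on \<open>E\<close> are extensional.\<close>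
definition flow_pairs ::
    "('k::idom \<Rightarrow> 'a::ab_group_add \<Rightarrow> 'a) \<Rightarrow> 'e set \<Rightarrow> 'm set \<Rightarrow> ('m \<Rightarrow> 'e \<Rightarrow> 'k) \<Rightarrow> int \<Rightarrow>
     (('e \<Rightarrow> 'a) \<times> ('e \<Rightarrow> 'a)) set" where
  "flow_pairs smul E R G k =
     {(f, g). f \<in> E \<rightarrow>\<^sub>E UNIV \<and> g \<in> E \<rightarrow>\<^sub>E UNIV \<and>
        is_flow smul E R G (\<lambda>e. f e - g e) \<and>
        int (card (supp E f)) - int (card (supp E g)) = k}"

definition zsmul :: "int \<Rightarrow> 'a::ab_group_add \<Rightarrow> 'a" where
  "zsmul n a = (if 0 \<le> n then \<Sum>i<nat n. a else - (\<Sum>i<nat (- n). a))"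

text \<open>
  The lists \<open>rs\<close>, \<open>cs\<close> select a square submatrix; their order only affects the sign.
\<close>
definition totally_unimodular :: "'e set \<Rightarrow> 'm set \<Rightarrow> ('m \<Rightarrow> 'e \<Rightarrow> int) \<Rightarrow> bool" where
  "totally_unimodular E R G \<longleftrightarrow>
     (\<forall>rs cs. set rs \<subseteq> R \<and> distinct rs \<and> set cs \<subseteq> E \<and> distinct cs \<and> length rs = length cs \<longrightarrow>
        Determinant.det (Matrix.mat (length rs) (length rs) (\<lambda>(i, j). G (rs ! i) (cs ! j))) \<in> {-1, 0, 1})"

text \<open>
  An undirected graph (loops and parallel edges allowed) with an arbitrary orientation is a
  digraph \<open>D\<close>.  The rows of the vertex-edge matrix are labelled by the vertices via \<open>\<rho>\<close>.
  Columns of loops are zero.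
\<close>
definition vertex_edge_matrix :: "('v, 'e) pre_digraph \<Rightarrow> 'm set \<Rightarrow> ('m \<Rightarrow> 'e \<Rightarrow> int) \<Rightarrow> bool" where
  "vertex_edge_matrix D R G \<longleftrightarrow>
     (\<exists>\<rho>. bij_betw \<rho> R (verts D) \<and>
        (\<forall>i\<in>R. \<forall>e\<in>arcs D. G i e = of_bool (head D e = \<rho> i) - of_bool (tail D e = \<rho> i)))"

text \<open>
  Each edge can be traversed along its orientation, as \<open>(e, True)\<close>, or against it, as
  \<open>(e, False)\<close>.
\<close>
definition both_ways :: "('v, 'e) pre_digraph \<Rightarrow> ('v, 'e \<times> bool) pre_digraph" where
  "both_ways D = \<lparr> verts = verts D, arcs = arcs D \<times> UNIV,
     tail = (\<lambda>(e, b). if b then tail D e else head D e),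
     head = (\<lambda>(e, b). if b then head D e else tail D e) \<rparr>"

text \<open>
  Traversals of the cycles of the underlying undirected graph.  Distinctness of the edges
  excludes going back and forth along a single edge; loops and digons are cycles.
\<close>
definition ucycle :: "('v, 'e) pre_digraph \<Rightarrow> ('e \<times> bool) list \<Rightarrow> bool" where
  "ucycle D p \<longleftrightarrow> pre_digraph.cycle (both_ways D) p \<and> distinct (map fst p)"

text \<open>
  The rows are labelled by all cycles, given as edge sets; each cycle is traversed in one of its
  two directions, chosen arbitrarily.
\<close>
definition cycle_edge_matrix :: "('v, 'e) pre_digraph \<Rightarrow> 'm set \<Rightarrow> ('m \<Rightarrow> 'e \<Rightarrow> int) \<Rightarrow> bool" where
  "cycle_edge_matrix D R G \<longleftrightarrow>
     (\<exists>\<rho>. bij_betw \<rho> R {fst ` set p | p. ucycle D p} \<and>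
        (\<forall>i\<in>R. \<exists>p. ucycle D p \<and> fst ` set p = \<rho> i \<and>
           (\<forall>e\<in>arcs D. G i e = of_bool ((e, True) \<in> set p) - of_bool ((e, False) \<in> set p))))"

end

theory Submission
  imports Defs "HOL-Analysis.Cartesian_Space"
begin

text \<open>
  Write \<open>z = 2 - X - 1/X\<close> and \<open>y = X - 2 + 1/X + q = q - z\<close>.  Substituting \<open>h = f - g\<close>, the left-hand
  side is a sum over flows \<open>h\<close> of a product over the edges, in which \<open>e\<close> contributes
  \<open>q = y + z\<close> if \<open>h e = 0\<close> and \<open>y\<close> otherwise.  Expanding the product gives
  \<open>z ^ card B * y ^ card (E - B)\<close> times the number of flows vanishing on \<open>B\<close>, summed over all
  \<open>B \<subseteq> E\<close>.  That number is \<open>q ^ (rk E - rk B)\<close>: in all cases of the theorem a column that depends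
  on a set \<open>I\<close> of independent columns is a combination of \<open>I\<close> with coefficients in the ring itself
  rather than in its field of fractions, so that a flow is determined by arbitrary values on a
  basis of \<open>E\<close>, and for a basis of \<open>E\<close> that extends a basis \<open>I\<close> of \<open>B\<close> it vanishes on \<open>B\<close> if and
  only if it vanishes on \<open>I\<close>.
\<close>

section \<open>Bases and flows\<close>

text \<open>Gaussian elimination without division: a pivot in row \<open>i\<close> is cleared by
  cross-multiplication, which leaves one row and one column less. In a domain the factor
  \<open>G i a\<close> cannot destroy a nonzero coefficient.\<close>

lemma nontrivial_relation:
  fixes G :: "'m \<Rightarrow> 'e \<Rightarrow> 'k::idom"
  assumes "finite S" "finite I" "card S < card I"
  shows "\<exists>c. (\<exists>e\<in>I. c e \<noteq> 0) \<and> (\<forall>i\<in>S. (\<Sum>e\<in>I. c e * G i e) = 0)"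
  using assms
proof (induction S arbitrary: I G rule: finite_induct)
  case empty
  then obtain e where "e \<in> I" by fastforce
  then show ?case by (intro exI[of _ "\<lambda>_. 1"]) auto
next
  case (insert i S)
  show ?case
  proof (cases "\<forall>e\<in>I. G i e = 0")
    case True
    from insert.IH[of I G] insert.prems insert.hyps
    obtain c where "\<exists>e\<in>I. c e \<noteq> 0" "\<forall>i\<in>S. (\<Sum>e\<in>I. c e * G i e) = 0" by auto
    with True show ?thesis by (intro exI[of _ c]) simp
  next
    case False
    then obtain a where a: "a \<in> I" "G i a \<noteq> 0" by auto
    \<comment> \<open>Column operations with pivot \<open>G i a\<close>: they make row
      \<open>i\<close> vanish on all other columns.\<close>
    define G' where "G' = (\<lambda>j e. G i a * G j e - G i e * G j a)"
    have "card S < card (I - {a})" using insert a by simp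
    from insert.IH[OF _ this, of G'] insert.prems obtain c where
      c: "\<exists>e\<in>I - {a}. c e \<noteq> 0" "\<And>j. j \<in> S \<Longrightarrow> (\<Sum>e\<in>I - {a}. c e * G' j e) = 0" by auto
    \<comment> \<open>Undoes the operations: the old coefficients are scaled by the pivot, and
      \<open>a\<close> collects all the multiples that were subtracted.\<close>
    define d where "d = (\<lambda>e. if e = a then - (\<Sum>e\<in>I - {a}. c e * G i e) else G i a * c e)"
    have eq: "(\<Sum>e\<in>I. d e * G j e) = (\<Sum>e\<in>I - {a}. c e * G' j e)" for j
    proof -
      have "(\<Sum>e\<in>I. d e * G j e) = d a * G j a + (\<Sum>e\<in>I - {a}. d e * G j e)"
        using insert.prems a by (simp add: sum.remove)
      also have "(\<Sum>e\<in>I - {a}. d e * G j e) = (\<Sum>e\<in>I - {a}. G i a * c e * G j e)"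
        by (rule sum.cong) (auto simp: d_def)
      also have "d a * G j a = (\<Sum>e\<in>I - {a}. - (c e * G i e * G j a))"
        by (simp add: d_def sum_distrib_right sum_negf)
      also have "(\<Sum>e\<in>I - {a}. - (c e * G i e * G j a)) + (\<Sum>e\<in>I - {a}. G i a * c e * G j e)
          = (\<Sum>e\<in>I - {a}. c e * G' j e)"
        by (subst sum.distrib[symmetric], rule sum.cong) (auto simp: G'_def algebra_simps)
      finally show ?thesis .
    qed
    have "(\<Sum>e\<in>I - {a}. c e * G' i e) = 0" by (rule sum.neutral) (simp add: G'_def)
    moreover have "\<exists>e\<in>I. d e \<noteq> 0" using c(1) a by (auto simp: d_def)
    ultimately show ?thesis using eq c(2) by (intro exI[of _ d]) auto
  qed
qed

lemma cols_indep_card_le_rows: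
  assumes "finite S" "finite I" "cols_indep S G I"
  shows "card I \<le> card S"
proof (rule ccontr)
  assume "\<not> card I \<le> card S"
  with nontrivial_relation[OF assms(1,2), of G] assms(3) show False
    unfolding cols_indep_def by (meson not_le)
qed

text \<open>The coefficients \<open>c\<close> form a matrix with rows \<open>J\<close> whose columns
  in \<open>I\<close> are independent, because a relation among them carries over to
  \<open>G\<close>. So the bound by the number of rows applies.\<close>

lemma cols_indep_card_le_spanning:
  assumes "finite I" "finite J" "cols_indep R G I"
    and span: "\<And>i e. i \<in> R \<Longrightarrow> e \<in> I \<Longrightarrow> G i e = (\<Sum>j\<in>J. c e j * G i j)"
  shows "card I \<le> card J"
proof (rule cols_indep_card_le_rows[OF assms(2,1), of "\<lambda>j e. c e j"])
  show "cols_indep J (\<lambda>j e. c e j) I"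
    unfolding cols_indep_def
  proof (intro allI impI)
    fix d assume d: "\<forall>j\<in>J. (\<Sum>e\<in>I. d e * c e j) = 0"
    have "(\<Sum>e\<in>I. d e * G i e) = 0" if "i \<in> R" for i
    proof -
      have "(\<Sum>e\<in>I. d e * G i e) = (\<Sum>e\<in>I. \<Sum>j\<in>J. d e * c e j * G i j)"
        using span that by (intro sum.cong refl) (simp add: sum_distrib_left mult.assoc)
      also have "\<dots> = (\<Sum>j\<in>J. (\<Sum>e\<in>I. d e * c e j) * G i j)"
        by (subst sum.swap) (simp add: sum_distrib_right)
      finally show ?thesis using d by simp
    qed
    with assms(3) show "\<forall>e\<in>I. d e = 0" unfolding cols_indep_def by blast
  qed
qed

lemma cols_indep_empty [simp]: "cols_indep R G {}"
  by (simp add: cols_indep_def)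

lemma cols_indep_mono:
  assumes "cols_indep R G J" "I \<subseteq> J" "finite J"
  shows "cols_indep R G I"
  unfolding cols_indep_def
proof (intro allI impI)
  fix c assume c: "\<forall>i\<in>R. (\<Sum>e\<in>I. c e * G i e) = 0"
  have "(\<Sum>e\<in>J. (if e \<in> I then c e else 0) * G i e) = (\<Sum>e\<in>I. c e * G i e)" for i
    using assms by (intro sum.mono_neutral_cong_right) auto
  with c assms(1) have "\<forall>e\<in>J. (if e \<in> I then c e else 0) = 0"
    unfolding cols_indep_def by presburger
  with assms(2) show "\<forall>e\<in>I. c e = 0" by (metis subsetD)
qed

lemma
  assumes "finite B"
  shows col_rank_upper: "I \<subseteq> B \<Longrightarrow> cols_indep R G I \<Longrightarrow> card I \<le> col_rank R G B"
    and col_rank_attained: "\<exists>I\<subseteq>B. cols_indep R G I \<and> card I = col_rank R G B"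
proof -
  let ?C = "card ` {I. I \<subseteq> B \<and> cols_indep R G I}"
  have fin: "finite ?C" using assms by auto
  show "I \<subseteq> B \<Longrightarrow> cols_indep R G I \<Longrightarrow> card I \<le> col_rank R G B"
    unfolding col_rank_def using fin by (intro Max_ge) auto
  have "?C \<noteq> {}" using cols_indep_empty by blast
  from Max_in[OF fin this] obtain I where "I \<subseteq> B" "cols_indep R G I" "Max ?C = card I" by auto
  then show "\<exists>I\<subseteq>B. cols_indep R G I \<and> card I = col_rank R G B"
    unfolding col_rank_def by metis
qed

lemma col_rank_le_card: "finite B \<Longrightarrow> col_rank R G B \<le> card B"
  using col_rank_attained card_mono by metis

text \<open>A basis of \<open>E\<close> meets \<open>B\<close> in an independent set and has at most
  \<open>card (E - B)\<close> other elements.\<close>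

lemma col_rank_le_card_diff:
  assumes "finite E" "B \<subseteq> E"
  shows "col_rank R G E \<le> col_rank R G B + card (E - B)"
proof -
  obtain I where I: "I \<subseteq> E" "cols_indep R G I" "card I = col_rank R G E"
    using col_rank_attained[OF assms(1)] by metis
  have "finite I" using I(1) assms(1) by (rule finite_subset)
  have "cols_indep R G (I \<inter> B)" using I(2) _ \<open>finite I\<close> by (rule cols_indep_mono) simp
  then have "card (I \<inter> B) \<le> col_rank R G B"
    using assms by (intro col_rank_upper) (auto intro: finite_subset)
  moreover have "card (I - B) \<le> card (E - B)" using I(1) assms by (intro card_mono) auto
  moreover have "card I = card (I \<inter> B) + card (I - B)"
    using card_Int_Diff[OF \<open>finite I\<close>] .
  ultimately show ?thesis using I(3) by simp
qed

lemma col_rank_mono: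
  assumes "finite E" "B \<subseteq> E"
  shows "col_rank R G B \<le> col_rank R G E"
proof -
  obtain I where "I \<subseteq> B" "cols_indep R G I" "card I = col_rank R G B"
    using col_rank_attained[OF finite_subset[OF assms(2,1)]] by metis
  then show ?thesis using col_rank_upper[OF assms(1)] assms(2) by (metis subset_trans)
qed

text \<open>A nontrivial relation that omitted \<open>e\<close> would contradict the independence of
  \<open>I\<close>. Each proof of \<open>unimodular_columns\<close> that starts from a dependent
  column begins with this relation.\<close>

lemma dependent_insert:
  fixes G :: "'m \<Rightarrow> 'e \<Rightarrow> 'k::idom"
  assumes "finite I" "e \<notin> I" "cols_indep R G I" "\<not> cols_indep R G (insert e I)"
  obtains x where "\<And>i. i \<in> R \<Longrightarrow> x e * G i e + (\<Sum>f\<in>I. x f * G i f) = 0" "x e \<noteq> 0"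
proof -
  obtain x f0 where x: "\<And>i. i \<in> R \<Longrightarrow> (\<Sum>f\<in>insert e I. x f * G i f) = 0"
    and f0: "f0 \<in> insert e I" "x f0 \<noteq> 0"
    using assms(4) unfolding cols_indep_def by blast
  have s: "x e * G i e + (\<Sum>f\<in>I. x f * G i f) = 0" if "i \<in> R" for i
    using x[OF that] assms(1,2) by simp
  have "x e \<noteq> 0"
  proof
    assume "x e = 0"
    with s have "\<forall>i\<in>R. (\<Sum>f\<in>I. x f * G i f) = 0" by simp
    with assms(3) f0 \<open>x e = 0\<close> show False unfolding cols_indep_def by blast
  qed
  with s that show ?thesis by blast
qed

section \<open>Bases with coefficients in the ring\<close>

text \<open>The common property of all admissible matrices: a domain alone only gives a combination
  equal to some nonzero multiple of column \<open>e\<close>. The special shape of \<open>G\<close>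
  enters the count of flows through this property alone.\<close>

definition unimodular_columns :: "'e set \<Rightarrow> 'm set \<Rightarrow> ('m \<Rightarrow> 'e \<Rightarrow> 'k::idom) \<Rightarrow> bool" where
  "unimodular_columns E R G \<longleftrightarrow>
     (\<forall>I e. I \<subseteq> E \<and> e \<in> E - I \<and> cols_indep R G I \<and> \<not> cols_indep R G (insert e I) \<longrightarrow>
        (\<exists>c. \<forall>i\<in>R. G i e = (\<Sum>j\<in>I. c j * G i j)))"

lemma unimodular_columns_field:
  fixes G :: "'m \<Rightarrow> 'e \<Rightarrow> 'k::field"
  assumes "finite E"
  shows "unimodular_columns E R G"
  unfolding unimodular_columns_def
proof (intro allI impI, elim conjE)
  fix I e
  assume I: "I \<subseteq> E" "cols_indep R G I" and e: "e \<in> E - I"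
    and dep: "\<not> cols_indep R G (insert e I)"
  have finI: "finite I" using I assms by (auto intro: finite_subset)
  obtain x where s: "\<And>i. i \<in> R \<Longrightarrow> x e * G i e + (\<Sum>f\<in>I. x f * G i f) = 0" and "x e \<noteq> 0"
    using dependent_insert[OF finI _ I(2) dep] e by blast
  have "G i e = (\<Sum>f\<in>I. (- x f / x e) * G i f)" if "i \<in> R" for i
  proof -
    have "(\<Sum>f\<in>I. (- x f / x e) * G i f) = - (\<Sum>f\<in>I. x f * G i f) / x e"
      by (simp add: sum_divide_distrib sum_negf)
    also have "- (\<Sum>f\<in>I. x f * G i f) = x e * G i e"
      using s[OF that] by (simp add: neg_eq_iff_add_eq_0 add.commute)
    finally show ?thesis using \<open>x e \<noteq> 0\<close> by simp
  qed
  then show "\<exists>c. \<forall>i\<in>R. G i e = (\<Sum>j\<in>I. c j * G i j)" by (intro exI[of _ "\<lambda>f. - x f / x e"]) blast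
qed

text \<open>\<open>J\<close> is maximal among the independent sets between \<open>I\<close> and
  \<open>E\<close>. Maximality and unimodularity make \<open>J\<close> spanning, and the exchange
  bound then gives it full rank. The last two properties of \<open>c\<close> normalise the
  coefficients: unit vectors on \<open>J\<close>, and support in \<open>I\<close> for the columns of
  \<open>B\<close>.\<close>

lemma nested_bases:
  fixes G :: "'m \<Rightarrow> 'e \<Rightarrow> 'k::idom"
  assumes "finite E" "unimodular_columns E R G" "B \<subseteq> E"
  obtains I J c where "I \<subseteq> B" "I \<subseteq> J" "J \<subseteq> E" "cols_indep R G J"
    "card I = col_rank R G B" "card J = col_rank R G E"
    "\<And>e i. e \<in> E \<Longrightarrow> i \<in> R \<Longrightarrow> G i e = (\<Sum>j\<in>J. c e j * G i j)"
    "\<And>e j. e \<in> J \<Longrightarrow> c e j = of_bool (j = e)"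
    "\<And>e j. e \<in> B \<Longrightarrow> j \<notin> I \<Longrightarrow> c e j = 0"
proof -
  have finB: "finite B" using assms by (auto intro: finite_subset)
  obtain I where I: "I \<subseteq> B" "cols_indep R G I" "card I = col_rank R G B"
    using col_rank_attained[OF finB] by metis
  define F where "F = {J. I \<subseteq> J \<and> J \<subseteq> E \<and> cols_indep R G J}"
  have "finite F" unfolding F_def using assms by auto
  moreover have "I \<in> F" unfolding F_def using I assms by auto
  ultimately obtain J where "J \<in> F" "I \<subseteq> J" and J_max: "\<And>K. K \<in> F \<Longrightarrow> J \<subseteq> K \<Longrightarrow> J = K"
    using finite_has_maximal2 by metis
  then have J: "I \<subseteq> J" "J \<subseteq> E" "cols_indep R G J" by (auto simp: F_def)
  have finJ: "finite J" using J assms(1) by (auto intro: finite_subset)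
  have finI: "finite I" using I finB by (auto intro: finite_subset)
  \<comment> \<open>A basis element in \<open>B\<close> outside \<open>I\<close> would exceed the
    rank of \<open>B\<close>. This makes the two normalisations of \<open>c\<close> compatible on
    columns that lie in both \<open>J\<close> and \<open>B\<close>.\<close>
  have JB: "e \<in> I" if "e \<in> J" "e \<in> B" for e
  proof (rule ccontr)
    assume "e \<notin> I"
    moreover have "card (insert e I) \<le> card I"
      using col_rank_upper[OF finB, of "insert e I" R G] cols_indep_mono[OF J(3), of "insert e I"]
        that I J finJ by auto
    ultimately show False using finI by simp
  qed
  have spanJ: "\<exists>c. \<forall>i\<in>R. G i e = (\<Sum>j\<in>J. c j * G i j)" if e: "e \<in> E" "e \<notin> J" for e
  proof -
    have "insert e J \<notin> F" using J_max[of "insert e J"] e by auto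
    then have "\<not> cols_indep R G (insert e J)" using J e by (auto simp: F_def)
    then show ?thesis using assms(2) J e unfolding unimodular_columns_def by blast
  qed
  have spanI: "\<exists>c. \<forall>i\<in>R. G i e = (\<Sum>j\<in>I. c j * G i j)" if e: "e \<in> B" "e \<notin> I" for e
  proof -
    have "\<not> cols_indep R G (insert e I)"
      using col_rank_upper[OF finB, of "insert e I" R G] e I finI by auto
    then show ?thesis using assms(2,3) I e unfolding unimodular_columns_def by blast
  qed
  \<comment> \<open>Three kinds of columns: those in \<open>J\<close> get a unit vector, those in
    \<open>B - J\<close> a combination of \<open>I\<close> padded by zeros, the rest any combination
    of \<open>J\<close>.\<close>
  have "\<exists>c. (\<forall>i\<in>R. G i e = (\<Sum>j\<in>J. c j * G i j)) \<and> (e \<in> J \<longrightarrow> (\<forall>j. c j = of_bool (j = e))) \<and>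
      (e \<in> B \<longrightarrow> (\<forall>j. j \<notin> I \<longrightarrow> c j = 0))" if "e \<in> E" for e
  proof (cases "e \<in> J")
    case True
    have "(\<Sum>j\<in>J. of_bool (j = e) * G i j) = (\<Sum>j\<in>J. if j = e then G i j else 0)" for i
      by (intro sum.cong) auto
    then show ?thesis using True finJ JB
      by (intro exI[of _ "\<lambda>j. of_bool (j = e)"]) (auto simp: sum.delta)
  next
    case eJ: False
    show ?thesis
    proof (cases "e \<in> B")
      case True
      with eJ J obtain c where c: "\<And>i. i \<in> R \<Longrightarrow> G i e = (\<Sum>j\<in>I. c j * G i j)" using spanI by blast
      have "(\<Sum>j\<in>J. (if j \<in> I then c j else 0) * G i j) = (\<Sum>j\<in>I. c j * G i j)" for i
        using J finJ by (intro sum.mono_neutral_cong_right) auto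
      with c eJ show ?thesis by (intro exI[of _ "\<lambda>j. if j \<in> I then c j else 0"]) auto
    next
      case False
      with spanJ[OF that eJ] eJ show ?thesis by blast
    qed
  qed
  then obtain c where c: "\<And>e. e \<in> E \<Longrightarrow> (\<forall>i\<in>R. G i e = (\<Sum>j\<in>J. c e j * G i j)) \<and>
      (e \<in> J \<longrightarrow> (\<forall>j. c e j = of_bool (j = e))) \<and> (e \<in> B \<longrightarrow> (\<forall>j. j \<notin> I \<longrightarrow> c e j = 0))"
    by metis
  have "card J = col_rank R G E"
  proof (rule antisym)
    show "card J \<le> col_rank R G E" using col_rank_upper[OF assms(1)] J by auto
    obtain K where K: "K \<subseteq> E" "cols_indep R G K" "card K = col_rank R G E"
      using col_rank_attained[OF assms(1)] by metis
    then have "card K \<le> card J"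
      using cols_indep_card_le_spanning[of K J R G c] finJ c finite_subset[OF K(1) assms(1)]
      by (meson subsetD)
    with K show "col_rank R G E \<le> card J" by simp
  qed
  show ?thesis
  proof (rule that)
    show "I \<subseteq> B" "I \<subseteq> J" "J \<subseteq> E" "cols_indep R G J" "card I = col_rank R G B" by fact+
    show "card J = col_rank R G E" by fact
    show "G i e = (\<Sum>j\<in>J. c e j * G i j)" if "e \<in> E" "i \<in> R" for e i
      using c[OF that(1)] that(2) by blast
    show "c e j = of_bool (j = e)" if "e \<in> J" for e j using c[of e] that J by blast
    show "c e j = 0" if "e \<in> B" "j \<notin> I" for e j using c[of e] that assms(3) by blast
  qed
qed

section \<open>Flows described by their values on a basis\<close>

text \<open>Testing against one suitable dual already forces the formula. Conversely, the
  independence of \<open>J\<close> makes every row orthogonal to \<open>G\<close> annihilate all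
  functions given by the formula.\<close>

lemma is_flow_iff:
  fixes G :: "'m \<Rightarrow> 'e \<Rightarrow> 'k::idom" and smul :: "'k \<Rightarrow> 'a::ab_group_add \<Rightarrow> 'a"
  assumes "Modules.module smul" and fin: "finite E"
    and J: "J \<subseteq> E" "cols_indep R G J" "card J = col_rank R G E"
    and c: "\<And>e i. e \<in> E \<Longrightarrow> i \<in> R \<Longrightarrow> G i e = (\<Sum>j\<in>J. c e j * G i j)"
    and delta: "\<And>e j. e \<in> J \<Longrightarrow> c e j = of_bool (j = e)"
  shows "is_flow smul E R G h \<longleftrightarrow> (\<forall>e\<in>E. h e = (\<Sum>j\<in>J. smul (c e j) (h j)))"
proof
  interpret Modules.module smul by fact
  have finJ: "finite J" using J fin by (auto intro: finite_subset)
  assume flow: "is_flow smul E R G h"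
  define m where "m = card (E - J)"
  obtain b where b: "bij_betw b {..<m} (E - J)"
    using ex_bij_betw_nat_finite[of "E - J"] fin by (auto simp: m_def atLeast0LessThan)
  \<comment> \<open>The fundamental dual: row \<open>k\<close> records the relation expressing
    column \<open>b k\<close> through \<open>J\<close>, and restricted to \<open>E - J\<close> it is
    an identity block. The enumeration \<open>b\<close> supplies the row numbers that
    \<open>is_flow\<close> expects.\<close>
  define H :: "nat \<Rightarrow> 'e \<Rightarrow> 'k" where
    "H = (\<lambda>k e. if e \<in> J then - c (b k) e else of_bool (e = b k))"
  have split: "(\<Sum>e\<in>E. f e) = (\<Sum>e\<in>J. f e) + (\<Sum>e\<in>E - J. f e)" for f :: "'e \<Rightarrow> 'b::comm_monoid_add"
    using sum.subset_diff[OF J(1) fin, of f] by (simp add: add.commute)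
  have bE: "b k \<in> E - J" if "k < m" for k using b that by (auto simp: bij_betw_def)
  have bsurj: "\<exists>k<m. b k = e" if "e \<in> E - J" for e
    using b that unfolding bij_betw_def by (metis imageE lessThan_iff)
  have "orth_dual E R G {..<m} H"
    unfolding orth_dual_def
  proof (intro conjI ballI)
    fix i k assume ik: "i \<in> R" "k \<in> {..<m}"
    have "(\<Sum>e\<in>E - J. G i e * H k e) = G i (b k)"
    proof -
      have "(\<Sum>e\<in>E - J. G i e * H k e) = (\<Sum>e\<in>E - J. if e = b k then G i e else 0)"
        by (rule sum.cong) (auto simp: H_def)
      then show ?thesis using fin bE[of k] ik by (simp add: sum.delta)
    qed
    moreover have "(\<Sum>e\<in>J. G i e * H k e) = - G i (b k)"
      using bE[of k] ik by (subst c) (auto simp: H_def sum_negf mult.commute)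
    ultimately show "(\<Sum>e\<in>E. G i e * H k e) = 0" by (simp add: split)
  next
    \<comment> \<open>The identity block bounds the rank of \<open>H\<close> from below by
      \<open>m\<close>; the number of rows bounds it from above.\<close>
    have "cols_indep {..<m} H (E - J)"
      unfolding cols_indep_def
    proof (intro allI impI ballI)
      fix d e assume d: "\<forall>i\<in>{..<m}. (\<Sum>e\<in>E - J. d e * H i e) = 0" and e: "e \<in> E - J"
      then obtain k where k: "k < m" "b k = e" using bsurj by blast
      have "(\<Sum>e\<in>E - J. d e * H k e) = (\<Sum>x\<in>E - J. if x = e then d x else 0)"
        using k by (intro sum.cong) (auto simp: H_def)
      then have "(\<Sum>e\<in>E - J. d e * H k e) = d e" using fin e by (simp add: sum.delta)
      with d k show "d e = 0" by auto
    qed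
    then have "m \<le> col_rank {..<m} H E"
      unfolding m_def by (intro col_rank_upper) (use fin in auto)
    moreover have "col_rank {..<m} H E \<le> m"
    proof -
      obtain K where "K \<subseteq> E" "cols_indep {..<m} H K" "card K = col_rank {..<m} H E"
        using col_rank_attained[OF fin] by metis
      then show ?thesis using cols_indep_card_le_rows[of "{..<m}" K H] fin finite_subset by fastforce
    qed
    moreover have "card E = card J + m"
      unfolding m_def using card_mono[OF fin J(1)] finJ J(1) by (simp add: card_Diff_subset)
    ultimately show "col_rank R G E + col_rank {..<m} H E = card E" using J by simp
  qed simp
  with flow have H: "(\<Sum>e\<in>E. smul (H k e) (h e)) = 0" if "k < m" for k
    using that unfolding is_flow_def by blast
  show "\<forall>e\<in>E. h e = (\<Sum>j\<in>J. smul (c e j) (h j))"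
  proof
    fix e assume e: "e \<in> E"
    show "h e = (\<Sum>j\<in>J. smul (c e j) (h j))"
    proof (cases "e \<in> J")
      case True
      then have "(\<Sum>j\<in>J. smul (c e j) (h j)) = (\<Sum>j\<in>J. if j = e then h j else 0)"
        by (intro sum.cong) (auto simp: delta)
      then show ?thesis using finJ True by (simp add: sum.delta)
    next
      case False
      then obtain k where k: "k < m" "b k = e" using bsurj e by blast
      have "(\<Sum>x\<in>E - J. smul (H k x) (h x)) = (\<Sum>x\<in>E - J. if x = e then h x else 0)"
        using k by (intro sum.cong) (auto simp: H_def)
      then have "(\<Sum>x\<in>E - J. smul (H k x) (h x)) = h e"
        using fin e False by (simp add: sum.delta)
      moreover have "(\<Sum>x\<in>J. smul (H k x) (h x)) = - (\<Sum>j\<in>J. smul (c e j) (h j))"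
        using k by (simp add: H_def sum_negf)
      ultimately show ?thesis using H[OF k(1)] by (simp add: split)
    qed
  qed
next
  interpret Modules.module smul by fact
  assume h: "\<forall>e\<in>E. h e = (\<Sum>j\<in>J. smul (c e j) (h j))"
  show "is_flow smul E R G h"
    unfolding is_flow_def
  proof (intro allI impI)
    fix m :: nat and H :: "nat \<Rightarrow> 'e \<Rightarrow> 'k" and k
    assume "orth_dual E R G {..<m} H" "k < m"
    then have orth: "(\<Sum>e\<in>E. G i e * H k e) = 0" if "i \<in> R" for i
      using that by (auto simp: orth_dual_def)
    \<comment> \<open>Orthogonality to \<open>G\<close> is rewritten as a relation among the columns
      of \<open>J\<close>, whose coefficients are the entries of row \<open>k\<close> of
      \<open>H\<close> times \<open>c\<close>; by independence they vanish.\<close>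
    have "(\<Sum>j\<in>J. (\<Sum>e\<in>E. H k e * c e j) * G i j) = 0" if i: "i \<in> R" for i
    proof -
      have "(\<Sum>j\<in>J. (\<Sum>e\<in>E. H k e * c e j) * G i j) = (\<Sum>e\<in>E. \<Sum>j\<in>J. H k e * c e j * G i j)"
        by (subst sum.swap) (simp add: sum_distrib_right)
      also have "\<dots> = (\<Sum>e\<in>E. H k e * (\<Sum>j\<in>J. c e j * G i j))"
        by (simp add: sum_distrib_left mult.assoc)
      also have "\<dots> = (\<Sum>e\<in>E. G i e * H k e)"
        by (intro sum.cong refl) (use c[OF _ i] in \<open>simp add: mult.commute\<close>)
      finally show ?thesis using orth[OF i] by simp
    qed
    then have z: "(\<Sum>e\<in>E. H k e * c e j) = 0" if "j \<in> J" for j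
      using J(2)[unfolded cols_indep_def, rule_format, of "\<lambda>j. \<Sum>e\<in>E. H k e * c e j" j] that by blast
    have "(\<Sum>e\<in>E. smul (H k e) (h e)) = (\<Sum>e\<in>E. \<Sum>j\<in>J. smul (H k e * c e j) (h j))"
    proof (rule sum.cong[OF refl])
      fix e assume "e \<in> E"
      then have "smul (H k e) (h e) = smul (H k e) (\<Sum>j\<in>J. smul (c e j) (h j))" using h by metis
      then show "smul (H k e) (h e) = (\<Sum>j\<in>J. smul (H k e * c e j) (h j))"
        by (simp add: scale_sum_right)
    qed
    also have "\<dots> = (\<Sum>j\<in>J. smul (\<Sum>e\<in>E. H k e * c e j) (h j))"
      by (subst sum.swap) (simp add: scale_sum_left)
    finally show "(\<Sum>e\<in>E. smul (H k e) (h e)) = 0" by (simp add: z)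
  qed
qed

text \<open>Restriction to \<open>J - I\<close> is a bijection onto all functions there: the values
  on \<open>I\<close> must be zero, those on \<open>J - I\<close> are free, and together they
  determine the flow.\<close>

lemma card_flows_vanishing:
  fixes G :: "'m \<Rightarrow> 'e \<Rightarrow> 'k::idom" and smul :: "'k \<Rightarrow> 'a::{ab_group_add,finite} \<Rightarrow> 'a"
  assumes "Modules.module smul" and fin: "finite E" and "unimodular_columns E R G" and B: "B \<subseteq> E"
  shows "card {h \<in> E \<rightarrow>\<^sub>E UNIV. is_flow smul E R G h \<and> (\<forall>e\<in>B. h e = 0)} =
    CARD('a) ^ (col_rank R G E - col_rank R G B)"
proof -
  interpret Modules.module smul by fact
  obtain I J c where IJ: "I \<subseteq> B" "I \<subseteq> J" "J \<subseteq> E" "cols_indep R G J"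
    "card I = col_rank R G B" "card J = col_rank R G E"
    and c: "\<And>e i. e \<in> E \<Longrightarrow> i \<in> R \<Longrightarrow> G i e = (\<Sum>j\<in>J. c e j * G i j)"
    and delta: "\<And>e j. e \<in> J \<Longrightarrow> c e j = of_bool (j = e)"
    and cB: "\<And>e j. e \<in> B \<Longrightarrow> j \<notin> I \<Longrightarrow> c e j = 0"
    by (rule nested_bases[OF fin assms(3) B]) blast
  note flow_iff = is_flow_iff[OF assms(1) fin IJ(3,4,6) c delta]
  have finJ: "finite J" using IJ(3) fin by (rule finite_subset)
  let ?F = "{h \<in> E \<rightarrow>\<^sub>E UNIV. is_flow smul E R G h \<and> (\<forall>e\<in>B. h e = 0)}"
  let ?A = "(J - I) \<rightarrow>\<^sub>E (UNIV :: 'a set)"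
  \<comment> \<open>Inverse of the restriction: the sum runs over \<open>J - I\<close> only, which
    amounts to assigning zero on \<open>I\<close>.\<close>
  define ext where "ext = (\<lambda>a. restrict (\<lambda>e. \<Sum>j\<in>J - I. smul (c e j) (a j)) E)"
  have ext_J: "ext a j = (if j \<in> I then 0 else a j)" if "j \<in> J" for a j
  proof -
    have "ext a j = (\<Sum>k\<in>J - I. if k = j then a k else 0)"
      using that IJ by (auto simp: ext_def delta intro!: sum.cong)
    then show ?thesis using that finJ by (simp add: sum.delta)
  qed
  have "bij_betw (\<lambda>h. restrict h (J - I)) ?F ?A"
  proof (rule bij_betwI[where g = ext])
    show "ext \<in> ?A \<rightarrow> ?F"
    proof
      fix a assume "a \<in> ?A"
      have "ext a e = (\<Sum>j\<in>J. smul (c e j) (ext a j))" if "e \<in> E" for e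
      proof -
        have "(\<Sum>j\<in>J. smul (c e j) (ext a j)) = (\<Sum>j\<in>J - I. smul (c e j) (a j))"
          using finJ by (intro sum.mono_neutral_cong_right) (auto simp: ext_J)
        then show ?thesis using that by (simp add: ext_def)
      qed
      moreover have "ext a e = 0" if "e \<in> B" for e
        using that B cB by (auto simp: ext_def intro!: sum.neutral)
      moreover have "ext a \<in> E \<rightarrow>\<^sub>E UNIV" by (simp add: ext_def)
      ultimately show "ext a \<in> ?F" using flow_iff by blast
    qed
    show "ext (restrict h (J - I)) = h" if "h \<in> ?F" for h
    proof
      fix e
      show "ext (restrict h (J - I)) e = h e"
      proof (cases "e \<in> E")
        case True
        then have "h e = (\<Sum>j\<in>J. smul (c e j) (h j))" using that flow_iff by blast
        also have "\<dots> = (\<Sum>j\<in>J - I. smul (c e j) (h j))"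
          using that finJ IJ by (intro sum.mono_neutral_right) auto
        finally show ?thesis using True by (simp add: ext_def)
      next
        case False
        then show ?thesis using that by (auto simp: ext_def PiE_def extensional_def)
      qed
    qed
    show "restrict (ext a) (J - I) = a" if "a \<in> ?A" for a
    proof
      fix e show "restrict (ext a) (J - I) e = a e"
        using that ext_J by (auto simp: restrict_def PiE_def extensional_def)
    qed
  qed auto
  then have "card ?F = card ?A" by (rule bij_betw_same_card)
  also have "\<dots> = CARD('a) ^ card (J - I)" using finJ by (simp add: card_funcsetE)
  finally show ?thesis using IJ finite_subset[OF IJ(2) finJ] by (simp add: card_Diff_subset)
qed

section \<open>Unimodular matrices\<close>

abbreviation minor_mat :: "('m \<Rightarrow> 'e \<Rightarrow> 'k) \<Rightarrow> 'm list \<Rightarrow> 'e list \<Rightarrow> 'k mat" where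
  "minor_mat G rs cs \<equiv> mat (length rs) (length rs) (\<lambda>(i, j). G (rs ! i) (cs ! j))"

text \<open>Laplace expansion along the bordering row. Its cofactors delete that row, so one
  \<open>d\<close> serves all \<open>i\<close>; if all these minors vanish, the expansion is a
  relation among columns.\<close>

lemma bordered_minor:
  fixes G :: "'m \<Rightarrow> 'e \<Rightarrow> 'k::idom"
  assumes len: "length rs = length cs" and "distinct cs"
  obtains d where "\<And>i. Determinant.det (minor_mat G (rs @ [i]) (cs @ [e])) =
    (\<Sum>f\<in>set cs. d f * G i f) + Determinant.det (minor_mat G rs cs) * G i e"
proof -
  define n where "n = length rs"
  define M where "M = (\<lambda>i. minor_mat G (rs @ [i]) (cs @ [e]))"
  have M: "M i \<in> carrier_mat (Suc n) (Suc n)" for i by (simp add: M_def n_def)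
  have nth_cs: "inj_on ((!) cs) {..<n}" "(!) cs ` {..<n} = set cs"
    using assms by (auto simp: n_def inj_on_nth set_conv_nth)
  have cof: "cofactor (M i) n j = cofactor (M i') n j" if "j \<le> n" for i i' j
  proof -
    have "mat_delete (M i) n j = mat_delete (M i') n j"
      by (rule eq_matI) (auto simp: mat_delete_def M_def n_def nth_append)
    then show ?thesis by (simp add: cofactor_def)
  qed
  have "mat_delete (M i) n n = minor_mat G rs cs" for i
    by (rule eq_matI) (use len in \<open>auto simp: mat_delete_def M_def n_def nth_append\<close>)
  then have cof_n: "cofactor (M i) n n = Determinant.det (minor_mat G rs cs)" for i
    by (simp add: cofactor_def)
  \<comment> \<open>\<open>undefined\<close> stands for any bordering row, which is legitimate by
    \<open>cof\<close>; the inverse of \<open>(!) cs\<close> turns a column into its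
    position.\<close>
  define d where "d = (\<lambda>f. cofactor (M undefined) n (the_inv_into {..<n} ((!) cs) f))"
  have "Determinant.det (M i) =
      (\<Sum>f\<in>set cs. d f * G i f) + Determinant.det (minor_mat G rs cs) * G i e" for i
  proof -
    have "Determinant.det (M i) = (\<Sum>j<Suc n. M i $$ (n, j) * cofactor (M i) n j)"
      by (rule laplace_expansion_row[OF M]) simp
    also have "\<dots> = (\<Sum>j<n. M i $$ (n, j) * cofactor (M i) n j) +
        G i e * Determinant.det (minor_mat G rs cs)"
      using len by (simp add: cof_n) (simp add: M_def n_def nth_append)
    also have "(\<Sum>j<n. M i $$ (n, j) * cofactor (M i) n j) = (\<Sum>j<n. d (cs ! j) * G i (cs ! j))"
    proof (rule sum.cong[OF refl])
      fix j assume "j \<in> {..<n}"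
      then have "d (cs ! j) = cofactor (M i) n j"
        using nth_cs(1) by (simp add: d_def the_inv_into_f_f cof[of j undefined i])
      moreover have "M i $$ (n, j) = G i (cs ! j)"
        using \<open>j \<in> {..<n}\<close> len by (simp add: M_def n_def nth_append)
      ultimately show "M i $$ (n, j) * cofactor (M i) n j = d (cs ! j) * G i (cs ! j)"
        by (simp add: mult.commute)
    qed
    also have "\<dots> = (\<Sum>f\<in>set cs. d f * G i f)"
      using sum.reindex[OF nth_cs(1), of "\<lambda>f. d f * G i f"] nth_cs(2) by simp
    finally show ?thesis by (simp add: mult.commute)
  qed
  then show ?thesis using that unfolding M_def by blast
qed

text \<open>A nonzero minor of greatest size must use all of \<open>I\<close>: if it missed a column
  \<open>e\<close>, every bordering by \<open>e\<close> would vanish, and the expansion would be a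
  relation in which \<open>e\<close> has the nonzero minor as coefficient.\<close>

lemma cols_indep_nonzero_minor:
  fixes G :: "'m \<Rightarrow> 'e \<Rightarrow> 'k::idom"
  assumes indep: "cols_indep R G I" and fin: "finite I"
  obtains rs cs where "set rs \<subseteq> R" "distinct rs" "set cs = I" "distinct cs"
    "length rs = length cs" "Determinant.det (minor_mat G rs cs) \<noteq> 0"
proof -
  define P where "P = (\<lambda>n. \<exists>rs cs. set rs \<subseteq> R \<and> distinct rs \<and> set cs \<subseteq> I \<and> distinct cs \<and>
    length rs = length cs \<and> Determinant.det (minor_mat G rs cs) \<noteq> 0 \<and> n = length cs)"
  \<comment> \<open>The empty minor has determinant 1, so a nonzero minor exists.\<close>
  have "P 0" unfolding P_def by (intro exI[of _ "[]"]) (simp add: det_dim_zero)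
  have bound: "n \<le> card I" if "P n" for n
    using that fin unfolding P_def by (metis card_mono distinct_card)
  define k where "k = Greatest P"
  have "P k" unfolding k_def using \<open>P 0\<close> bound by (rule GreatestI_nat)
  then obtain rs cs where k: "set rs \<subseteq> R" "distinct rs" "set cs \<subseteq> I" "distinct cs"
    "length rs = length cs" "Determinant.det (minor_mat G rs cs) \<noteq> 0" "k = length cs"
    unfolding P_def by blast
  have "\<not> P (Suc k)" unfolding k_def using Greatest_le_nat[of P _ "card I"] bound
    by (metis Suc_n_not_le_n)
  have "set cs = I"
  proof (rule ccontr)
    assume "set cs \<noteq> I"
    with k obtain e where e: "e \<in> I" "e \<notin> set cs" by auto
    obtain d where d: "\<And>i. Determinant.det (minor_mat G (rs @ [i]) (cs @ [e])) =
        (\<Sum>f\<in>set cs. d f * G i f) + Determinant.det (minor_mat G rs cs) * G i e"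
      using bordered_minor[OF k(5,4), where G = G and e = e] by blast
    \<comment> \<open>A row already in \<open>rs\<close> gives two equal rows; a new row would give
      a nonzero minor of size \<open>Suc k\<close>.\<close>
    have zero: "Determinant.det (minor_mat G (rs @ [i]) (cs @ [e])) = 0" if i: "i \<in> R" for i
    proof (cases "i \<in> set rs")
      case True
      then obtain t where t: "t < length rs" "rs ! t = i" by (auto simp: in_set_conv_nth)
      show ?thesis
      proof (rule det_identical_rows[of _ "Suc (length rs)" t "length rs"])
        show "row (minor_mat G (rs @ [i]) (cs @ [e])) t =
            row (minor_mat G (rs @ [i]) (cs @ [e])) (length rs)"
          by (rule eq_vecI) (use t in \<open>auto simp: nth_append\<close>)
      qed (use t in auto)
    next
      case False
      show ?thesis
      proof (rule ccontr)
        assume "Determinant.det (minor_mat G (rs @ [i]) (cs @ [e])) \<noteq> 0"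
        then have "P (Suc k)" unfolding P_def
          by (intro exI[of _ "rs @ [i]"] exI[of _ "cs @ [e]"]) (use k e i False in auto)
        with \<open>\<not> P (Suc k)\<close> show False by simp
      qed
    qed
    define c where "c = (\<lambda>f. if f = e then Determinant.det (minor_mat G rs cs)
      else if f \<in> set cs then d f else 0)"
    have "(\<Sum>f\<in>I. c f * G i f) = 0" if "i \<in> R" for i
    proof -
      have "(\<Sum>f\<in>I. c f * G i f) = (\<Sum>f\<in>insert e (set cs). c f * G i f)"
        using fin k e by (intro sum.mono_neutral_right) (auto simp: c_def)
      also have "\<dots> = c e * G i e + (\<Sum>f\<in>set cs. d f * G i f)"
        using e by (subst sum.insert) (auto simp: c_def intro!: sum.cong)
      finally show ?thesis using zero[OF that] d[of i] by (simp add: c_def add.commute)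
    qed
    with indep e have "c e = 0" unfolding cols_indep_def by blast
    with k show False by (simp add: c_def)
  qed
  with that k show ?thesis by blast
qed

text \<open>
  A nonzero minor on all columns of \<open>I\<close> is \<open>1\<close> or \<open>-1\<close>.  Bordered by the column \<open>e\<close> and any row \<open>i\<close>
  it vanishes, and the expansion along the row \<open>i\<close>, whose cofactors do not depend on \<open>i\<close>, is
  Cramer's rule for the column \<open>e\<close>.
\<close>
lemma totally_unimodular_imp_unimodular_columns:
  fixes G :: "'m \<Rightarrow> 'e \<Rightarrow> int"
  assumes "finite E" "totally_unimodular E R G"
  shows "unimodular_columns E R G"
  unfolding unimodular_columns_def
proof (intro allI impI, elim conjE)
  fix I e
  assume I: "I \<subseteq> E" "cols_indep R G I" and e: "e \<in> E - I"
    and dep: "\<not> cols_indep R G (insert e I)"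
  have finI: "finite I" using I assms by (auto intro: finite_subset)
  obtain rs cs where rc: "set rs \<subseteq> R" "distinct rs" "set cs = I" "distinct cs"
    "length rs = length cs" "Determinant.det (minor_mat G rs cs) \<noteq> 0"
    using cols_indep_nonzero_minor[OF I(2) finI] by metis
  define D where "D = Determinant.det (minor_mat G rs cs)"
  have "D \<in> {-1, 0, 1}"
    unfolding D_def using assms(2) rc I unfolding totally_unimodular_def by blast
  \<comment> \<open>\<open>D\<close> is its own inverse, so the expansion can be solved for column
    \<open>e\<close> over the integers.\<close>
  with rc(6) have D: "D * D = 1" unfolding D_def by auto
  obtain d where d: "\<And>i. Determinant.det (minor_mat G (rs @ [i]) (cs @ [e])) =
      (\<Sum>f\<in>set cs. d f * G i f) + D * G i e"
    unfolding D_def using bordered_minor[OF rc(5,4), where G = G and e = e] by blast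
  have "e \<notin> I" using e by simp
  from dependent_insert[OF finI this I(2) dep]
  obtain x where "\<And>i. i \<in> R \<Longrightarrow> x e * G i e + (\<Sum>f\<in>I. x f * G i f) = 0" and xe: "x e \<noteq> 0" by blast
  then have x: "\<And>i. i \<in> R \<Longrightarrow> (\<Sum>f\<in>insert e I. x f * G i f) = 0" using finI \<open>e \<notin> I\<close> by simp
  let ?n = "length rs" and ?cs = "cs @ [e]"
  have cs': "set ?cs = insert e I" "distinct ?cs" "length ?cs = Suc ?n" using rc e by auto
  \<comment> \<open>Every row of the bordered matrix, repeated or not, is a row of \<open>G\<close>
    on the columns \<open>insert e I\<close>, so the relation \<open>x\<close> is a kernel vector.
    Its last entry \<open>x e\<close> is nonzero.\<close>
  have zero: "Determinant.det (minor_mat G (rs @ [i]) ?cs) = 0" if i: "i \<in> R" for i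
  proof -
    let ?M = "minor_mat G (rs @ [i]) ?cs"
    let ?v = "vec (Suc ?n) (\<lambda>j. x (?cs ! j))"
    have "?v \<noteq> 0\<^sub>v (Suc ?n)"
    proof
      assume z: "?v = 0\<^sub>v (Suc ?n)"
      have "?v $ ?n = 0" using z by simp
      with xe rc(5) show False by simp
    qed
    moreover have "?M *\<^sub>v ?v = 0\<^sub>v (Suc ?n)"
    proof (rule eq_vecI)
      fix t assume "t < dim_vec (0\<^sub>v (Suc ?n))"
      then have t: "t < Suc ?n" by simp
      let ?i = "(rs @ [i]) ! t"
      have "?i \<in> set (rs @ [i])" using t by (intro nth_mem) auto
      then have iR: "?i \<in> R" using rc i by auto
      have "(?M *\<^sub>v ?v) $ t = (\<Sum>j = 0..<Suc ?n. G ?i (?cs ! j) * x (?cs ! j))"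
        using t by (simp add: scalar_prod_def)
      also have "\<dots> = (\<Sum>f\<in>insert e I. G ?i f * x f)"
        using sum.reindex[of "(!) ?cs" "{0..<Suc ?n}" "\<lambda>f. G ?i f * x f"] cs'
          inj_on_nth[OF cs'(2), of "{0..<Suc ?n}"] nth_image[of "Suc ?n" ?cs]
        by (auto simp: atLeast0LessThan)
      finally show "(?M *\<^sub>v ?v) $ t = 0\<^sub>v (Suc ?n) $ t" using x[OF iR] t by (simp add: mult.commute)
    qed simp
    moreover have "?v \<in> carrier_vec (Suc ?n)" "?M \<in> carrier_mat (Suc ?n) (Suc ?n)" by auto
    ultimately show ?thesis using det_0_iff_vec_prod_zero by blast
  qed
  have "G i e = (\<Sum>f\<in>I. (- D * d f) * G i f)" if i: "i \<in> R" for i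
  proof -
    have "(\<Sum>f\<in>I. (- D * d f) * G i f) = - D * (\<Sum>f\<in>I. d f * G i f)"
      by (simp add: sum_distrib_left mult.assoc)
    also have "(\<Sum>f\<in>I. d f * G i f) = - (D * G i e)"
      using d[of i] zero[OF i] rc(3) by (simp add: eq_neg_iff_add_eq_0)
    finally show ?thesis using D by (simp add: mult.assoc[symmetric])
  qed
  then show "\<exists>c. \<forall>i\<in>R. G i e = (\<Sum>j\<in>I. c j * G i j)" by (intro exI[of _ "\<lambda>f. - D * d f"]) blast
qed

section \<open>Matrices of graphs\<close>

text \<open>A column with at most one nonzero entry is expanded, which reduces the size. Otherwise
  every column has exactly one 1 and one -1, and the rows add up to zero. The ends
  \<open>h j\<close> and \<open>t j\<close> need not be among the row labels, so that the form
  survives deleting rows.\<close>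

lemma det_incidence_matrix:
  fixes r h t :: "nat \<Rightarrow> 'v"
  assumes "inj_on r {..<n}"
  shows "Determinant.det (mat n n (\<lambda>(i, j). of_bool (h j = r i) - of_bool (t j = r i) :: int)) \<in> {-1, 0, 1}"
  using assms
proof (induction n arbitrary: r h t)
  case 0
  then show ?case by (simp add: det_dim_zero)
next
  case (Suc n)
  let ?A = "mat (Suc n) (Suc n) (\<lambda>(i, j). of_bool (h j = r i) - of_bool (t j = r i) :: int)"
  have A: "?A \<in> carrier_mat (Suc n) (Suc n)" by simp
  show ?case
  proof (cases "\<exists>j<Suc n. \<exists>i0<Suc n. \<forall>i<Suc n. i \<noteq> i0 \<longrightarrow> ?A $$ (i, j) = 0")
    case True
    then obtain j i0 where j: "j < Suc n" and i0: "i0 < Suc n"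
      and z: "\<And>i. i < Suc n \<Longrightarrow> i \<noteq> i0 \<Longrightarrow> ?A $$ (i, j) = 0" by blast
    \<comment> \<open>\<open>?s k\<close> skips the index \<open>k\<close>; composing with it brings
      the reduced matrix into the form of the induction hypothesis.\<close>
    let ?s = "\<lambda>k i. if i < k then i else Suc i"
    have inj: "inj_on (r \<circ> ?s i0) {..<n}"
      using i0 by (intro comp_inj_on inj_on_subset[OF Suc.prems]) (auto simp: inj_on_def split: if_splits)
    have "mat_delete ?A i0 j = mat n n (\<lambda>(i, j'). of_bool ((h \<circ> ?s j) j' = (r \<circ> ?s i0) i) -
        of_bool ((t \<circ> ?s j) j' = (r \<circ> ?s i0) i))"
      by (rule eq_matI) (use i0 j in \<open>auto simp: mat_delete_def\<close>)
    with Suc.IH[OF inj, of "h \<circ> ?s j" "t \<circ> ?s j"]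
    have "Determinant.det (mat_delete ?A i0 j) \<in> {-1, 0, 1}" by (simp only:)
    moreover have "(-1 :: int) ^ (i0 + j) \<in> {-1, 1}" by (cases "even (i0 + j)") simp_all
    moreover have "?A $$ (i0, j) \<in> {-1, 0, 1}" using i0 j by auto
    moreover have "Determinant.det ?A = (\<Sum>i<Suc n. ?A $$ (i, j) * cofactor ?A i j)"
      by (rule laplace_expansion_column[OF A j])
    then have "Determinant.det ?A = ?A $$ (i0, j) * cofactor ?A i0 j"
      using z i0 by (subst (asm) sum.remove[of _ i0]) auto
    ultimately show ?thesis unfolding cofactor_def by (auto simp del: index_mat)
  next
    case False
    \<comment> \<open>Otherwise column \<open>j\<close> would be zero or have a single nonzero
      entry, which is excluded in this case.\<close>
    have two: "h j \<noteq> t j \<and> h j \<in> r ` {..<Suc n} \<and> t j \<in> r ` {..<Suc n}" if j: "j < Suc n" for j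
    proof (rule ccontr)
      assume neg: "\<not> ?thesis"
      have "\<exists>i0<Suc n. \<forall>i<Suc n. i \<noteq> i0 \<longrightarrow> ?A $$ (i, j) = 0"
      proof (cases "h j = t j \<or> h j \<notin> r ` {..<Suc n} \<and> t j \<notin> r ` {..<Suc n}")
        case True
        then show ?thesis using j by (intro exI[of _ 0]) auto
      next
        case False
        with neg obtain i0 where i0: "i0 < Suc n" "h j = r i0 \<and> t j \<notin> r ` {..<Suc n} \<or>
            t j = r i0 \<and> h j \<notin> r ` {..<Suc n}" by auto
        have "?A $$ (i, j) = 0" if "i < Suc n" "i \<noteq> i0" for i
        proof -
          have "r i \<noteq> r i0" using Suc.prems that i0 by (auto simp: inj_on_def)
          then show ?thesis using i0(2) that j by auto
        qed
        with i0 show ?thesis by blast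
      qed
      with False j show False by blast
    qed
    have col: "(\<Sum>i<Suc n. of_bool (v = r i)) = (1::int)" if v: "v \<in> r ` {..<Suc n}" for v
    proof -
      obtain a where a: "a < Suc n" "v = r a" using v by auto
      then have "(\<Sum>i<Suc n. of_bool (v = r i)) = (\<Sum>i<Suc n. if i = a then 1 else 0 :: int)"
        using Suc.prems by (intro sum.cong) (auto simp: inj_on_def)
      then show ?thesis using a by simp
    qed
    \<comment> \<open>The all-ones vector is in the kernel of the transpose, as each column sums to
      zero.\<close>
    let ?v = "vec (Suc n) (\<lambda>_. 1 :: int)"
    have "?A\<^sup>T *\<^sub>v ?v = 0\<^sub>v (Suc n)"
    proof (rule eq_vecI)
      fix j assume "j < dim_vec (0\<^sub>v (Suc n) :: int vec)"
      then have j: "j < Suc n" by simp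
      then have "(?A\<^sup>T *\<^sub>v ?v) $ j = (\<Sum>i<Suc n. of_bool (h j = r i) - of_bool (t j = r i))"
        by (simp add: scalar_prod_def atLeast0LessThan del: sum.lessThan_Suc sum.op_ivl_Suc)
      also have "\<dots> = 0" unfolding sum_subtractf using col two[OF j] by (simp del: sum.lessThan_Suc)
      finally show "(?A\<^sup>T *\<^sub>v ?v) $ j = 0\<^sub>v (Suc n) $ j" using j by simp
    qed simp
    moreover have "?v \<noteq> 0\<^sub>v (Suc n)" by (metis index_vec index_zero_vec(1) zero_less_Suc zero_neq_one)
    moreover have "?v \<in> carrier_vec (Suc n)" "?A\<^sup>T \<in> carrier_mat (Suc n) (Suc n)" by auto
    ultimately have "Determinant.det ?A\<^sup>T = 0" using det_0_iff_vec_prod_zero by blast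
    then show ?thesis using det_transpose[OF A] by simp
  qed
qed

lemma vertex_edge_matrix_totally_unimodular:
  assumes "vertex_edge_matrix D R G"
  shows "totally_unimodular (arcs D) R G"
  unfolding totally_unimodular_def
proof (intro allI impI, elim conjE)
  fix rs cs
  assume rc: "set rs \<subseteq> R" "distinct rs" "set cs \<subseteq> arcs D" "distinct cs" "length rs = length cs"
  obtain \<rho> where \<rho>: "bij_betw \<rho> R (verts D)"
    "\<And>i e. i \<in> R \<Longrightarrow> e \<in> arcs D \<Longrightarrow> G i e = of_bool (head D e = \<rho> i) - of_bool (tail D e = \<rho> i)"
    using assms unfolding vertex_edge_matrix_def by blast
  have "minor_mat G rs cs = mat (length rs) (length rs) (\<lambda>(i, j).
      of_bool (head D (cs ! j) = \<rho> (rs ! i)) - of_bool (tail D (cs ! j) = \<rho> (rs ! i)))"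
  proof (rule cong_mat)
    fix i j assume "i < length rs" "j < length rs"
    then have "rs ! i \<in> R" "cs ! j \<in> arcs D" using rc nth_mem[of i rs] nth_mem[of j cs] by auto
    from \<rho>(2)[OF this] show "(case (i, j) of (i, j) \<Rightarrow> G (rs ! i) (cs ! j)) = (case (i, j) of (i, j) \<Rightarrow>
        of_bool (head D (cs ! j) = \<rho> (rs ! i)) - of_bool (tail D (cs ! j) = \<rho> (rs ! i)))" by simp
  qed simp_all
  moreover have "inj_on (\<lambda>i. \<rho> (rs ! i)) {..<length rs}"
  proof (rule inj_onI)
    fix a b assume ab: "a \<in> {..<length rs}" "b \<in> {..<length rs}" "\<rho> (rs ! a) = \<rho> (rs ! b)"
    then have "rs ! a \<in> R" "rs ! b \<in> R" using rc(1) nth_mem by auto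
    with ab \<rho>(1) have "rs ! a = rs ! b" by (meson bij_betw_def inj_on_def)
    with ab rc show "a = b" by (simp add: nth_eq_iff_index_eq)
  qed
  ultimately show "Determinant.det (minor_mat G rs cs) \<in> {-1, 0, 1}"
    using det_incidence_matrix[of "\<lambda>i. \<rho> (rs ! i)" "length rs" "\<lambda>j. head D (cs ! j)" "\<lambda>j. tail D (cs ! j)"]
    by simp
qed

section \<open>Cycles and cuts in the underlying undirected graph\<close>

lemma both_ways_simps [simp]:
  "verts (both_ways D) = verts D" "arcs (both_ways D) = arcs D \<times> UNIV"
  "tail (both_ways D) (e, b) = (if b then tail D e else head D e)"
  "head (both_ways D) (e, b) = (if b then head D e else tail D e)"
  by (simp_all add: both_ways_def)

lemma wf_digraph_both_ways: "wf_digraph D \<Longrightarrow> wf_digraph (both_ways D)"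
  by unfold_locales (auto simp: wf_digraph.wellformed)

lemma (in pre_digraph) ends_in_awalk_verts:
  assumes "cas u p v" "x \<in> set p"
  shows "tail G x \<in> set (awalk_verts u p)" "head G x \<in> set (awalk_verts u p)"
proof -
  show "tail G x \<in> set (awalk_verts u p)" using assms(2) by (auto simp: awalk_verts_conv)
  show "head G x \<in> set (awalk_verts u p)"
    using assms(2) by (auto simp: awalk_verts_conv'[OF assms(1)])
qed

text \<open>A second traversal of an edge, in either direction, would revisit the tail of the first.
  This supplies the distinct edges that \<open>ucycle\<close> demands when a path is closed
  up.\<close>

lemma apath_both_ways_distinct:
  assumes "distinct (pre_digraph.awalk_verts (both_ways D) u p)" "pre_digraph.cas (both_ways D) u p v"
  shows "distinct (map fst p)"
  using assms
proof (induction p arbitrary: u)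
  case (Cons x p)
  let ?B = "both_ways D"
  have d: "tail ?B x \<notin> set (pre_digraph.awalk_verts ?B (head ?B x) p)"
    "distinct (pre_digraph.awalk_verts ?B (head ?B x) p)" "pre_digraph.cas ?B (head ?B x) p v"
    using Cons.prems by (auto simp: pre_digraph.awalk_verts.simps pre_digraph.cas.simps)
  have "fst x \<notin> fst ` set p"
  proof
    assume "fst x \<in> fst ` set p"
    then obtain y where y: "y \<in> set p" "fst x = fst y" by auto
    obtain f a b where "x = (f, a)" "y = (f, b)" using y(2) by (metis prod.collapse)
    then have "tail ?B x = tail ?B y \<or> tail ?B x = head ?B y" by auto
    with pre_digraph.ends_in_awalk_verts[OF d(3) y(1)] d(1) show False by metis
  qed
  with Cons.IH[OF d(2,3)] show ?case by simp
qed simp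

lemma sum_list_telescope:
  fixes \<phi> :: "'v \<Rightarrow> 'b::ab_group_add"
  assumes "pre_digraph.cas D u p v"
  shows "(\<Sum>x\<leftarrow>p. \<phi> (head D x) - \<phi> (tail D x)) = \<phi> v - \<phi> u"
  using assms by (induction p arbitrary: u) (auto simp: pre_digraph.cas.simps)

text \<open>A closed walk enters \<open>U\<close> as often as it leaves: along the walk, the
  differences of the indicator function of \<open>U\<close> telescope to zero.\<close>

lemma cut_orthogonal_cycle:
  fixes U :: "'v set" and D :: "('v, 'e) pre_digraph"
  assumes fin: "finite (arcs D)" and p: "ucycle D p"
  shows "(\<Sum>f\<in>arcs D. (of_bool (head D f \<in> U) - of_bool (tail D f \<in> U) :: int) *
    (of_bool ((f, True) \<in> set p) - of_bool ((f, False) \<in> set p))) = 0"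
proof -
  let ?B = "both_ways D"
  let ?g = "\<lambda>x. of_bool (head ?B x \<in> U) - of_bool (tail ?B x \<in> U) :: int"
  obtain u where u: "pre_digraph.awalk ?B u p u"
    using p unfolding ucycle_def pre_digraph.cycle_def by blast
  have sub: "set p \<subseteq> arcs D \<times> UNIV" and cas: "pre_digraph.cas ?B u p u"
    using u by (auto simp: pre_digraph.awalk_def)
  have "distinct p" using p by (simp add: ucycle_def distinct_map)
  have "(\<Sum>f\<in>arcs D. (of_bool (head D f \<in> U) - of_bool (tail D f \<in> U) :: int) *
      (of_bool ((f, True) \<in> set p) - of_bool ((f, False) \<in> set p))) =
      (\<Sum>f\<in>arcs D. \<Sum>b\<in>UNIV. if (f, b) \<in> set p then ?g (f, b) else 0)"
    by (intro sum.cong refl) (auto simp: UNIV_bool)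
  also have "\<dots> = (\<Sum>x\<in>arcs D \<times> UNIV. if x \<in> set p then ?g x else 0)"
    by (subst sum.cartesian_product) (auto intro!: sum.cong)
  also have "\<dots> = (\<Sum>x\<in>set p. ?g x)"
    using sub fin by (intro sum.mono_neutral_cong_right) auto
  also have "\<dots> = (\<Sum>x\<leftarrow>p. ?g x)" using \<open>distinct p\<close> by (rule sum_list_distinct_conv_sum_set[symmetric])
  also have "\<dots> = 0" using sum_list_telescope[OF cas, of "\<lambda>v. of_bool (v \<in> U) :: int"] by simp
  finally show ?thesis .
qed

text \<open>
  If \<open>x\<close> is a dependence of the columns with \<open>x e \<noteq> 0\<close>, the vertices that can be reached from the
  head of \<open>e\<close> outside the support of \<open>x\<close> define a cut contained in that support.  It contains
  \<open>e\<close>, since otherwise there would be a cycle meeting the support in \<open>e\<close> only.  Cuts have entries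
  in \<open>{-1, 0, 1}\<close> and are orthogonal to all cycles.
\<close>
lemma cycle_edge_matrix_imp_unimodular_columns:
  fixes D :: "('v, 'e) pre_digraph"
  assumes "fin_digraph D" and G: "cycle_edge_matrix D R G"
  shows "unimodular_columns (arcs D) R G"
  unfolding unimodular_columns_def
proof (intro allI impI, elim conjE)
  interpret fin_digraph D by fact
  interpret B: wf_digraph "both_ways D" by (rule wf_digraph_both_ways) unfold_locales
  fix I e
  assume I: "I \<subseteq> arcs D" "cols_indep R G I" and e: "e \<in> arcs D - I"
    and dep: "\<not> cols_indep R G (insert e I)"
  have finI: "finite I" using I by (auto intro: finite_subset)
  have "e \<notin> I" using e by simp
  from dependent_insert[OF finI this I(2) dep]
  obtain x where x: "\<And>i. i \<in> R \<Longrightarrow> x e * G i e + (\<Sum>f\<in>I. x f * G i f) = 0" and xe: "x e \<noteq> 0" by blast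
  obtain \<rho> where \<rho>: "bij_betw \<rho> R {fst ` set p | p. ucycle D p}"
    and rows: "\<And>i. i \<in> R \<Longrightarrow> \<exists>p. ucycle D p \<and> fst ` set p = \<rho> i \<and>
      (\<forall>e\<in>arcs D. G i e = of_bool ((e, True) \<in> set p) - of_bool ((e, False) \<in> set p))"
    using G unfolding cycle_edge_matrix_def by blast
  define S where "S = {f \<in> insert e I. x f \<noteq> 0}"
  define U where "U = {v. \<exists>p. B.awalk (head D e) p v \<and> fst ` set p \<inter> S = {}}"
  define \<delta> where "\<delta> = (\<lambda>f. of_bool (head D f \<in> U) - of_bool (tail D f \<in> U) :: int)"
  have step: "head (both_ways D) a \<in> U"
    if a: "tail (both_ways D) a \<in> U" "a \<in> arcs (both_ways D)" "fst a \<notin> S" for a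
  proof -
    obtain p where p: "B.awalk (head D e) p (tail (both_ways D) a)" "fst ` set p \<inter> S = {}"
      using a(1) unfolding U_def by blast
    have "B.awalk (head D e) (p @ [a]) (head (both_ways D) a)"
      using B.awalk_appendI[OF p(1) B.arc_implies_awalk[OF a(2)]] .
    moreover have "fst ` set (p @ [a]) \<inter> S = {}" using p(2) a(3) by auto
    ultimately show ?thesis unfolding U_def by blast
  qed
  have \<delta>_zero: "\<delta> f = 0" if "f \<in> arcs D" "f \<notin> S" for f
  proof -
    have "head D f \<in> U" if "tail D f \<in> U"
      using step[of "(f, True)"] that \<open>f \<in> arcs D\<close> \<open>f \<notin> S\<close> by simp
    moreover have "tail D f \<in> U" if "head D f \<in> U"
      using step[of "(f, False)"] that \<open>f \<in> arcs D\<close> \<open>f \<notin> S\<close> by simp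
    ultimately show ?thesis unfolding \<delta>_def by fastforce
  qed
  have head_U: "head D e \<in> U"
    unfolding U_def using e by (auto intro!: exI[of _ "[]"] simp: B.awalk_Nil_iff)
  have tail_U: "tail D e \<notin> U"
  proof
    assume "tail D e \<in> U"
    then obtain p where p: "B.awalk (head D e) p (tail D e)" "fst ` set p \<inter> S = {}"
      unfolding U_def by blast
    \<comment> \<open>Shortening the walk to a path ensures that closing it with \<open>e\<close>
      yields a cycle; its edges still avoid \<open>S\<close>.\<close>
    define t where "t = B.awalk_to_apath p"
    have t: "B.apath (head D e) t (tail D e)" "set t \<subseteq> set p"
      unfolding t_def using B.apath_awalk_to_apath[OF p(1)] B.awalk_to_apath_subset[OF p(1)] by auto
    have tS: "fst ` set t \<inter> S = {}" using p(2) t(2) by blast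
    have "e \<in> S" using xe by (simp add: S_def)
    have "B.awalk (head D e) t (tail D e)" "distinct (B.awalk_verts (head D e) t)"
      using t(1) by (auto simp: B.apath_def)
    then have "B.cycle ((e, True) # t)"
      unfolding B.cycle_def using e by (intro exI[of _ "tail D e"]) (auto simp: B.awalk_Cons_iff)
    moreover have "distinct (map fst t)"
      using apath_both_ways_distinct t(1) by (auto simp: B.apath_def B.awalk_def)
    moreover have "e \<notin> fst ` set t" using tS \<open>e \<in> S\<close> by blast
    ultimately have "ucycle D ((e, True) # t)" by (simp add: ucycle_def)
    then have "fst ` set ((e, True) # t) \<in> \<rho> ` R" using \<rho> unfolding bij_betw_def by blast
    then obtain i where i: "i \<in> R" "\<rho> i = insert e (fst ` set t)" by auto
    \<comment> \<open>The row belongs to some traversal \<open>w\<close> of this edge set, possibly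
      in the other direction; only its set of edges is used.\<close>
    from rows[OF i(1)] i(2) obtain w where w: "ucycle D w" "fst ` set w = insert e (fst ` set t)"
      "\<And>f. f \<in> arcs D \<Longrightarrow> G i f = of_bool ((f, True) \<in> set w) - of_bool ((f, False) \<in> set w)"
      by auto
    \<comment> \<open>Inside \<open>S\<close> the cycle avoids \<open>f\<close>, outside
      \<open>S\<close> the coefficient is zero. So only the term of \<open>e\<close> survives in row
      \<open>i\<close>.\<close>
    have "x f * G i f = 0" if f: "f \<in> I" for f
    proof (cases "f \<in> S")
      case True
      then have "f \<notin> fst ` set w" using w(2) tS f e by auto
      then have "(f, b) \<notin> set w" for b by force
      then have "G i f = 0" using w(3) f I by auto
      then show ?thesis by simp
    qed (use f in \<open>simp add: S_def\<close>)
    then have "(\<Sum>f\<in>I. x f * G i f) = 0" by (intro sum.neutral) blast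
    then have "x e * G i e = 0" using x[OF i(1)] by simp
    then have "G i e = 0" using xe by simp
    \<comment> \<open>The cycle uses \<open>e\<close>, so a zero entry could only arise from both
      directions cancelling, against the distinctness of its edges.\<close>
    moreover have "\<exists>b. (e, b) \<in> set w" using w(2) by (metis fst_conv imageE insertI1 prod.collapse)
    ultimately have "(e, True) \<in> set w" "(e, False) \<in> set w"
      using w(3)[of e] e by (auto split: if_splits simp: of_bool_def) (metis (full_types))+
    moreover have "inj_on fst (set w)" using w(1) by (simp add: ucycle_def distinct_map)
    ultimately have "(e, True) = (e, False)" by (auto dest: inj_onD[where x = "(e, True)" and y = "(e, False)"])
    then show False by simp
  qed
  \<comment> \<open>The cut \<open>\<delta>\<close> is supported in \<open>insert e I\<close> and
    equals 1 at \<open>e\<close>, so its orthogonality to the cycle rows expresses column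
    \<open>e\<close>.\<close>
  have "G i e = (\<Sum>f\<in>I. (- \<delta> f) * G i f)" if i: "i \<in> R" for i
  proof -
    from rows[OF i] obtain w where w: "ucycle D w"
      "\<And>f. f \<in> arcs D \<Longrightarrow> G i f = of_bool ((f, True) \<in> set w) - of_bool ((f, False) \<in> set w)"
      by blast
    have "(\<Sum>f\<in>arcs D. \<delta> f * G i f) = 0"
      using cut_orthogonal_cycle[OF finite_arcs w(1), of U] w(2) by (simp add: \<delta>_def)
    moreover have "(\<Sum>f\<in>arcs D. \<delta> f * G i f) = (\<Sum>f\<in>insert e I. \<delta> f * G i f)"
      using e I \<delta>_zero by (intro sum.mono_neutral_right) (auto simp: S_def)
    moreover have "\<delta> e = 1" using head_U tail_U by (simp add: \<delta>_def)
    ultimately show ?thesis using e finI by (simp add: sum_negf eq_neg_iff_add_eq_0)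
  qed
  then show "\<exists>c. \<forall>i\<in>R. G i e = (\<Sum>j\<in>I. c j * G i j)" by (intro exI[of _ "\<lambda>f. - \<delta> f"]) blast
qed

section \<open>The generating function\<close>

text \<open>Only finitely many degrees occur. Summing over pairs instead of degrees makes the weight
  a product over the edges.\<close>

lemma Sum_any_fibres:
  fixes X :: "'b::field" and deg :: "'c \<Rightarrow> int"
  assumes "finite P"
  shows "Sum_any (\<lambda>k. of_nat (card {p \<in> P. deg p = k}) * X powi k) = (\<Sum>p\<in>P. X powi deg p)"
proof -
  have "Sum_any (\<lambda>k. of_nat (card {p \<in> P. deg p = k}) * X powi k) =
      (\<Sum>k\<in>deg ` P. of_nat (card {p \<in> P. deg p = k}) * X powi k)"
  proof (rule Sum_any.expand_superset)
    show "{k. of_nat (card {p \<in> P. deg p = k}) * X powi k \<noteq> 0} \<subseteq> deg ` P"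
    proof
      fix k assume "k \<in> {k. of_nat (card {p \<in> P. deg p = k}) * X powi k \<noteq> 0}"
      then have "{p \<in> P. deg p = k} \<noteq> {}" by (metis (mono_tags, lifting) card.empty mem_Collect_eq mult_zero_left of_nat_0)
      then show "k \<in> deg ` P" by auto
    qed
  qed (use assms in simp)
  also have "\<dots> = (\<Sum>k\<in>deg ` P. \<Sum>p\<in>{p \<in> P. deg p = k}. X powi deg p)"
    by (intro sum.cong refl) simp
  also have "\<dots> = (\<Sum>p\<in>P. X powi deg p)"
    using assms by (intro sum.group) auto
  finally show ?thesis .
qed

lemma power_card_supp:
  fixes X :: "'b::comm_monoid_mult"
  assumes "finite E"
  shows "X ^ card (supp E f) = (\<Prod>e\<in>E. if f e \<noteq> 0 then X else 1)"
  using assms by (simp add: supp_def flip: prod.inter_filter)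

text \<open>The contribution of one edge with \<open>h e = a\<close>, summed over
  \<open>g e = b\<close>. For \<open>a = 0\<close> the weights cancel and every \<open>b\<close>
  counts 1; otherwise only \<open>b = 0\<close> and \<open>b = - a\<close> deviate from 1, with
  weights \<open>X\<close> and \<open>inverse X\<close>. The result is split in two for the later
  expansion.\<close>

lemma sum_translated_weights:
  fixes X :: "'b::field" and a :: "'a::{ab_group_add,finite}"
  assumes "X \<noteq> 0"
  shows "(\<Sum>b\<in>UNIV. (if a + b \<noteq> 0 then X else 1) * (if b \<noteq> 0 then inverse X else 1)) =
    (if a = 0 then 2 - X - inverse X else 0) + (X - 2 + inverse X + of_nat CARD('a))"
proof (cases "a = 0")
  case True
  then have "(\<Sum>b\<in>UNIV. (if a + b \<noteq> 0 then X else 1) * (if b \<noteq> 0 then inverse X else 1)) =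
      (\<Sum>b\<in>(UNIV :: 'a set). 1)"
    using assms by (intro sum.cong) auto
  then show ?thesis using True by simp
next
  case False
  have "(\<Sum>b\<in>UNIV. (if a + b \<noteq> 0 then X else 1) * (if b \<noteq> 0 then inverse X else 1)) =
      (\<Sum>b\<in>UNIV. 1 + (if b = 0 then X - 1 else 0) + (if b = - a then inverse X - 1 else 0))"
  proof (intro sum.cong refl)
    fix b :: 'a
    have "a + b = 0 \<longleftrightarrow> b = - a" by (metis add.commute eq_neg_iff_add_eq_0)
    then show "(if a + b \<noteq> 0 then X else 1) * (if b \<noteq> 0 then inverse X else 1) =
        1 + (if b = 0 then X - 1 else 0) + (if b = - a then inverse X - 1 else 0)"
      using assms False by auto
  qed
  also have "\<dots> = of_nat CARD('a) + (X - 1) + (inverse X - 1)"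
    by (simp add: sum.distrib)
  finally show ?thesis using False by simp
qed

lemma is_flow_cong:
  assumes "\<And>e. e \<in> E \<Longrightarrow> h e = h' e"
  shows "is_flow smul E R G h \<longleftrightarrow> is_flow smul E R G h'"
  unfolding is_flow_def using assms by (simp cong: sum.cong)

lemma sum_flow_pairs:
  fixes X :: "'b::field" and smul :: "'k::idom \<Rightarrow> 'a::{ab_group_add,finite} \<Rightarrow> 'a"
    and E :: "'e set"
  assumes fin: "finite E" and X: "X \<noteq> 0"
  defines "z \<equiv> 2 - X - inverse X" and "y \<equiv> X - 2 + inverse X + of_nat CARD('a)"
  shows "Sum_any (\<lambda>k. of_nat (card (flow_pairs smul E R G k)) * X powi k) =
    (\<Sum>B\<in>Pow E. of_nat (card {h \<in> E \<rightarrow>\<^sub>E UNIV. is_flow smul E R G h \<and> (\<forall>e\<in>B. h e = 0)}) *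
      (z ^ card B * y ^ card (E - B)))"
proof -
  let ?A = "E \<rightarrow>\<^sub>E (UNIV :: 'a set)"
  define F where "F = {h \<in> ?A. is_flow smul E R G h}"
  define P where "P = {(f, g). f \<in> ?A \<and> g \<in> ?A \<and> is_flow smul E R G (\<lambda>e. f e - g e)}"
  define deg where "deg = (\<lambda>(f :: 'e \<Rightarrow> 'a, g :: 'e \<Rightarrow> 'a). int (card (supp E f)) - int (card (supp E g)) :: int)"
  define w where "w = (\<lambda>a b :: 'a. (if a + b \<noteq> 0 then X else 1) * (if b \<noteq> 0 then inverse X else 1))"
  have finA: "finite ?A" using fin by (simp add: finite_PiE)
  then have finF: "finite F" by (simp add: F_def)
  have finP: "finite P" by (rule finite_subset[of _ "?A \<times> ?A"]) (use finA in \<open>auto simp: P_def\<close>)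
  have "flow_pairs smul E R G k = {p \<in> P. deg p = k}" for k
    by (auto simp: flow_pairs_def P_def deg_def)
  then have "Sum_any (\<lambda>k. of_nat (card (flow_pairs smul E R G k)) * X powi k) = (\<Sum>p\<in>P. X powi deg p)"
    using Sum_any_fibres[OF finP, of deg X] by simp
  \<comment> \<open>Change of variables from \<open>(f, g)\<close> to \<open>(f - g, g)\<close>;
    \<open>restrict\<close> keeps the functions extensional.\<close>
  also have "\<dots> = (\<Sum>(h, g)\<in>F \<times> ?A. \<Prod>e\<in>E. w (h e) (g e))"
  proof (rule sum.reindex_bij_witness[where
        i = "\<lambda>(h, g). (restrict (\<lambda>e. h e + g e) E, g)" and
        j = "\<lambda>(f, g). (restrict (\<lambda>e. f e - g e) E, g)"])
    fix p assume "p \<in> P"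
    then obtain f g where p: "p = (f, g)" "f \<in> ?A" "g \<in> ?A" "is_flow smul E R G (\<lambda>e. f e - g e)"
      by (auto simp: P_def)
    have "restrict (\<lambda>e. restrict (\<lambda>e. f e - g e) E e + g e) E = f"
      using p(2) by (auto simp: fun_eq_iff PiE_def extensional_def restrict_def)
    then show "(case case p of (f, g) \<Rightarrow> (restrict (\<lambda>e. f e - g e) E, g) of
        (h, g) \<Rightarrow> (restrict (\<lambda>e. h e + g e) E, g)) = p" using p(1) by simp
    have "is_flow smul E R G (restrict (\<lambda>e. f e - g e) E)"
      by (rule iffD2[OF is_flow_cong p(4)]) simp
    then show "(case p of (f, g) \<Rightarrow> (restrict (\<lambda>e. f e - g e) E, g)) \<in> F \<times> ?A"
      using p by (auto simp: F_def)
    have "X powi deg p = X ^ card (supp E f) * inverse X ^ card (supp E g)"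
      using X p(1) by (simp add: deg_def power_int_diff power_inverse divide_inverse)
    also have "\<dots> = (\<Prod>e\<in>E. w (f e - g e) (g e))"
      unfolding power_card_supp[OF fin] by (simp add: w_def flip: prod.distrib)
    finally show "(case case p of (f, g) \<Rightarrow> (restrict (\<lambda>e. f e - g e) E, g) of
        (h, g) \<Rightarrow> \<Prod>e\<in>E. w (h e) (g e)) = X powi deg p" using p(1) by simp
  next
    fix p assume "p \<in> F \<times> ?A"
    then obtain h g where p: "p = (h, g)" "h \<in> ?A" "g \<in> ?A" "is_flow smul E R G h"
      by (auto simp: F_def)
    have "restrict (\<lambda>e. restrict (\<lambda>e. h e + g e) E e - g e) E = h"
      using p(2) by (auto simp: fun_eq_iff PiE_def extensional_def restrict_def)
    then show "(case case p of (h, g) \<Rightarrow> (restrict (\<lambda>e. h e + g e) E, g) of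
        (f, g) \<Rightarrow> (restrict (\<lambda>e. f e - g e) E, g)) = p" using p(1) by simp
    have "is_flow smul E R G (\<lambda>e. restrict (\<lambda>e. h e + g e) E e - g e)"
      by (rule iffD2[OF is_flow_cong p(4)]) simp
    then show "(case p of (h, g) \<Rightarrow> (restrict (\<lambda>e. h e + g e) E, g)) \<in> P"
      using p by (auto simp: P_def)
  qed
  also have "\<dots> = (\<Sum>h\<in>F. \<Sum>g\<in>?A. \<Prod>e\<in>E. w (h e) (g e))"
    by (simp add: sum.cartesian_product)
  \<comment> \<open>The values of \<open>g\<close> on different edges are independent, so the sum
    over \<open>g\<close> factors.\<close>
  also have "\<dots> = (\<Sum>h\<in>F. \<Prod>e\<in>E. \<Sum>b\<in>UNIV. w (h e) b)"
    using fin by (simp add: prod_sum_PiE)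
  also have "\<dots> = (\<Sum>h\<in>F. \<Prod>e\<in>E. (if h e = 0 then z else 0) + y)"
    unfolding w_def sum_translated_weights[OF X] z_def y_def by simp
  \<comment> \<open>\<open>B\<close> is the set of edges at which the first summand is chosen; its
    term survives only if \<open>h\<close> vanishes on \<open>B\<close>.\<close>
  also have "\<dots> = (\<Sum>h\<in>F. \<Sum>B\<in>Pow E. (if \<forall>e\<in>B. h e = 0 then z ^ card B * y ^ card (E - B) else 0))"
  proof (intro sum.cong refl)
    fix h
    have "(\<Prod>e\<in>B. if h e = 0 then z else 0) = (if \<forall>e\<in>B. h e = 0 then z ^ card B else 0)"
      if "B \<subseteq> E" for B
      using finite_subset[OF that fin] by (auto simp: prod_zero_iff)
    then show "(\<Prod>e\<in>E. (if h e = 0 then z else 0) + y) =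
        (\<Sum>B\<in>Pow E. (if \<forall>e\<in>B. h e = 0 then z ^ card B * y ^ card (E - B) else 0))"
      unfolding prod_add[OF fin] by (intro sum.cong refl) auto
  qed
  also have "\<dots> = (\<Sum>B\<in>Pow E. \<Sum>h\<in>F. (if \<forall>e\<in>B. h e = 0 then z ^ card B * y ^ card (E - B) else 0))"
    by (rule sum.swap)
  also have "\<dots> = (\<Sum>B\<in>Pow E. of_nat (card {h \<in> ?A. is_flow smul E R G h \<and> (\<forall>e\<in>B. h e = 0)}) *
      (z ^ card B * y ^ card (E - B)))"
    using finF by (intro sum.cong refl) (simp add: F_def conj_assoc flip: sum.inter_filter)
  finally show ?thesis .
qed

text \<open>With the count of flows vanishing on \<open>B\<close> inserted, the expansion agrees
  with the rank polynomial summand by summand; the prefactor absorbs the denominators.\<close>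

lemma sum_flow_pairs_eq_rank_poly:
  fixes X :: "'b::field" and smul :: "'k::idom \<Rightarrow> 'a::{ab_group_add,finite} \<Rightarrow> 'a"
    and E :: "'e set"
  assumes mod: "Modules.module smul" and fin: "finite E" and uni: "unimodular_columns E R G"
    and q: "q = CARD('a)" and r: "r = col_rank R G E" and X: "X \<noteq> 0"
    and z: "2 - X - inverse X \<noteq> 0" and y: "X - 2 + inverse X + of_nat q \<noteq> 0"
  shows "Sum_any (\<lambda>k. of_nat (card (flow_pairs smul E R G k)) * X powi k) =
    (2 - X - inverse X) ^ r * (X - 2 + inverse X + of_nat q) ^ (card E - r) *
    rank_poly E (col_rank R G)
      (of_nat q * (X - 2 + inverse X + of_nat q) / (2 - X - inverse X))
      ((2 - X - inverse X) / (X - 2 + inverse X + of_nat q))"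
proof -
  define z where "z = 2 - X - inverse X"
  define y where "y = X - 2 + inverse X + of_nat q"
  have nz: "z \<noteq> 0" "y \<noteq> 0" using assms by (simp_all add: z_def y_def)
  have summand: "of_nat (q ^ (r - col_rank R G B)) * (z ^ card B * y ^ card (E - B)) =
      z ^ r * y ^ (card E - r) *
      ((of_nat q * y / z) ^ (r - col_rank R G B) * (z / y) ^ (card B - col_rank R G B))"
    if B: "B \<subseteq> E" for B
  proof -
    define s where "s = r - col_rank R G B"
    define t where "t = card B - col_rank R G B"
    have finB: "finite B" using B fin by (rule finite_subset)
    have "col_rank R G B \<le> r" "r \<le> card E" "col_rank R G B \<le> card B"
        "r \<le> col_rank R G B + card (E - B)" "card E = card B + card (E - B)"
      using col_rank_mono[OF fin B] col_rank_le_card[OF fin] col_rank_le_card[OF finB]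
        col_rank_le_card_diff[OF fin B] card_mono[OF fin B] B finB
      by (auto simp: r card_Diff_subset)
    \<comment> \<open>By the inequalities above the truncated differences are genuine, so the
      exponents of \<open>z\<close> and \<open>y\<close> match after multiplication by
      \<open>z ^ s * y ^ t\<close>.\<close>
    then have exps: "card B + s = r + t" "card (E - B) + t = card E - r + s"
      by (auto simp: s_def t_def)
    have "z ^ card B * y ^ card (E - B) * (z ^ s * y ^ t) =
        (z ^ card B * z ^ s) * (y ^ card (E - B) * y ^ t)" by (simp add: ac_simps)
    also have "\<dots> = z ^ (r + t) * y ^ (card E - r + s)"
      by (simp only: exps flip: power_add)
    finally have "z ^ card B * y ^ card (E - B) * (z ^ s * y ^ t) =
        z ^ r * y ^ (card E - r) * (y ^ s * z ^ t)" by (simp add: power_add ac_simps)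
    then have "z ^ card B * y ^ card (E - B) =
        z ^ r * y ^ (card E - r) * (y ^ s * z ^ t) / (z ^ s * y ^ t)"
      using nz by (simp add: eq_divide_eq)
    then show ?thesis
      unfolding s_def[symmetric] t_def[symmetric] by (simp add: power_divide power_mult_distrib)
  qed
  have "Sum_any (\<lambda>k. of_nat (card (flow_pairs smul E R G k)) * X powi k) =
      (\<Sum>B\<in>Pow E. of_nat (q ^ (r - col_rank R G B)) * (z ^ card B * y ^ card (E - B)))"
    unfolding sum_flow_pairs[OF fin X] z_def y_def q r
    by (intro sum.cong refl) (simp add: card_flows_vanishing[OF mod fin uni])
  also have "\<dots> = z ^ r * y ^ (card E - r) * rank_poly E (col_rank R G) (of_nat q * y / z) (z / y)"
    unfolding rank_poly_def sum_distrib_left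
    by (intro sum.cong refl) (simp only: summand Pow_iff r[symmetric])
  finally show ?thesis by (simp add: z_def y_def)
qed

section \<open>Integer multiples, the indeterminate, and both settings\<close>

lemma module_zsmul: "Modules.module (zsmul :: int \<Rightarrow> 'a::ab_group_add \<Rightarrow> 'a)"
proof
  \<comment> \<open>Evaluating \<open>zsmul\<close> on a difference of naturals frees additivity in
    the scalar from a case distinction on signs.\<close>
  have zsmul_diff: "zsmul (int m - int n) a = (\<Sum>i<m. a) - (\<Sum>i<n. a)" for m n and a :: 'a
  proof (cases "n \<le> m")
    case True
    then obtain k where "m = n + k" using le_Suc_ex by blast
    moreover have "(\<Sum>i<n + k. a) = (\<Sum>i<n. a) + (\<Sum>i<k. a)" by (induction k) (simp_all add: add.assoc)
    ultimately show ?thesis by (simp add: zsmul_def)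
  next
    case False
    then obtain k where k: "n = m + k" using le_Suc_ex nat_le_linear by metis
    moreover have "(\<Sum>i<m + k. a) = (\<Sum>i<m. a) + (\<Sum>i<k. a)" by (induction k) (simp_all add: add.assoc)
    ultimately show ?thesis using False by (simp add: zsmul_def)
  qed
  have add_nat: "(\<Sum>i<m + n. a) = (\<Sum>i<m. a) + (\<Sum>i<n. a)" for m n :: nat and a :: 'a
    by (induction n) (simp_all add: add.assoc)
  show left: "zsmul (x + y) a = zsmul x a + zsmul y a" for x y and a :: 'a
  proof -
    obtain m n m' n' where xy: "x = int m - int n" "y = int m' - int n'" by (metis int_diff_cases)
    then have "x + y = int (m + m') - int (n + n')" by simp
    then have "zsmul (x + y) a = (\<Sum>i<m + m'. a) - (\<Sum>i<n + n'. a)" by (simp only: zsmul_diff)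
    then show ?thesis by (simp only: xy zsmul_diff add_nat) (simp add: algebra_simps)
  qed
  show right: "zsmul x (a + b) = zsmul x a + zsmul x b" for x and a b :: 'a
    by (simp add: zsmul_def sum.distrib)
  show "zsmul 1 a = a" for a :: 'a by (simp add: zsmul_def)
  have zero: "zsmul 0 a = 0" for a :: 'a by (simp add: zsmul_def)
  have neg: "zsmul (- x) a = - zsmul x a" for x and a :: 'a
    using left[of x "- x" a] zero by (simp add: eq_neg_iff_add_eq_0 add.commute)
  show "zsmul x (zsmul y a) = zsmul (x * y) a" for x y and a :: 'a
  proof (induction x rule: int_induct[where k = 0])
    case base
    then show ?case by (simp add: zero)
  next
    case (step1 i)
    then show ?case using left[of i 1 "zsmul y a"] left[of "i * y" y a] \<open>\<And>a :: 'a. zsmul 1 a = a\<close>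
      by (simp add: distrib_right)
  next
    case (step2 i)
    then show ?case using left[of i "- 1" "zsmul y a"] left[of "i * y" "- y" a] neg[of 1] neg[of y]
        \<open>\<And>a :: 'a. zsmul 1 a = a\<close>
      by (simp add: left_diff_distrib)
  qed
qed

text \<open>Multiplication by \<open>X\<close> turns the expressions into polynomials with leading
  coefficients -1 and 1, whatever \<open>q\<close> is. Hence the quotients in the rank polynomial
  are genuine and never fall back on the convention for division by zero.\<close>

lemma fract_indeterminate_nonzero:
  fixes X :: "'a::idom poly fract" and q :: nat
  assumes X: "X = Fract [:0, 1:] 1"
  shows "X \<noteq> 0" "2 - X - inverse X \<noteq> 0" "X - 2 + inverse X + of_nat q \<noteq> 0"
proof -
  show X0: "X \<noteq> 0" by (simp add: X Zero_fract_def eq_fract)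
  have two: "(2 :: 'a poly fract) = Fract 2 1" using Fract_of_nat_eq[of 2] by simp
  have ofq: "(of_nat q :: 'a poly fract) = Fract (of_nat q) 1" by (simp add: Fract_of_nat_eq)
  have "(2 - X - inverse X) * X = 2 * X - X * X - 1" using X0 by (simp add: algebra_simps)
  also have "\<dots> = Fract (2 * [:0, 1:] - [:0, 1:] * [:0, 1:] - 1) 1"
    by (simp add: X two One_fract_def)
  also have "2 * [:0, 1:] - [:0, 1:] * [:0, 1:] - 1 = [:-1, 2, -1 :: 'a:]" 
    by (simp add: one_pCons numeral_poly)
  finally have "(2 - X - inverse X) * X \<noteq> 0" by (simp add: Zero_fract_def eq_fract)
  then show "2 - X - inverse X \<noteq> 0" by (metis mult_zero_left)
  have "(X - 2 + inverse X + of_nat q) * X = X * X - 2 * X + 1 + of_nat q * X"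
    using X0 by (simp add: algebra_simps)
  also have "\<dots> = Fract ([:0, 1:] * [:0, 1:] - 2 * [:0, 1:] + 1 + of_nat q * [:0, 1:]) 1"
    by (simp add: X two ofq One_fract_def)
  also have "[:0, 1:] * [:0, 1:] - 2 * [:0, 1:] + 1 + of_nat q * [:0, 1:] = [:1, of_nat q - 2, 1 :: 'a:]"
    by (simp add: one_pCons numeral_poly of_nat_poly)
  finally have "(X - 2 + inverse X + of_nat q) * X \<noteq> 0" by (simp add: Zero_fract_def eq_fract)
  then show "X - 2 + inverse X + of_nat q \<noteq> 0" by (metis mult_zero_left)
qed

theorem theorem7p1:
  fixes X :: "rat poly fract" and E :: "'e set" and R :: "'m set" and q r :: nat
  assumes X: "X = Fract [:0, 1:] 1"
    and "finite E" and "finite R"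
  shows
    "(\<forall>(D :: ('v, 'e) pre_digraph) (G :: 'm \<Rightarrow> 'e \<Rightarrow> int).
        (fin_digraph D \<and> arcs D = E \<and> vertex_edge_matrix D R G \<or>
         fin_digraph D \<and> arcs D = E \<and> cycle_edge_matrix D R G \<or>
         totally_unimodular E R G) \<and>
        q = CARD('a::{ab_group_add, finite}) \<and> r = col_rank R G E \<longrightarrow>
        Sum_any (\<lambda>k::int. of_nat (card (flow_pairs (zsmul :: int \<Rightarrow> 'a \<Rightarrow> 'a) E R G k)) * X powi k) =
          (2 - X - inverse X) ^ r * (X - 2 + inverse X + of_nat q) ^ (card E - r) *
          rank_poly E (col_rank R G)
            (of_nat q * (X - 2 + inverse X + of_nat q) / (2 - X - inverse X))
            ((2 - X - inverse X) / (X - 2 + inverse X + of_nat q))) \<and>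
     (\<forall>(G :: 'm \<Rightarrow> 'e \<Rightarrow> 'k::{field, finite}) (p::nat) (s::nat).
        prime p \<and> CARD('k) = p ^ s \<and> q = p ^ (s * CARD('d::finite)) \<and> r = col_rank R G E \<longrightarrow>
        Sum_any (\<lambda>k::int. of_nat (card (flow_pairs ((*s) :: 'k \<Rightarrow> 'k ^ 'd \<Rightarrow> 'k ^ 'd) E R G k)) * X powi k) =
          (2 - X - inverse X) ^ r * (X - 2 + inverse X + of_nat q) ^ (card E - r) *
          rank_poly E (col_rank R G)
            (of_nat q * (X - 2 + inverse X + of_nat q) / (2 - X - inverse X))
            ((2 - X - inverse X) / (X - 2 + inverse X + of_nat q)))"
proof -
  note nz = fract_indeterminate_nonzero[OF X]
  have *: "Sum_any (\<lambda>k::int. of_nat (card (flow_pairs (zsmul :: int \<Rightarrow> 'a \<Rightarrow> 'a) E R G k)) * X powi k) =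
      (2 - X - inverse X) ^ r * (X - 2 + inverse X + of_nat q) ^ (card E - r) *
      rank_poly E (col_rank R G)
        (of_nat q * (X - 2 + inverse X + of_nat q) / (2 - X - inverse X))
        ((2 - X - inverse X) / (X - 2 + inverse X + of_nat q))"
    if "fin_digraph D \<and> arcs D = E \<and> vertex_edge_matrix D R G \<or>
        fin_digraph D \<and> arcs D = E \<and> cycle_edge_matrix D R G \<or> totally_unimodular E R G"
      and "q = CARD('a)" and "r = col_rank R G E"
    for D :: "('v, 'e) pre_digraph" and G :: "'m \<Rightarrow> 'e \<Rightarrow> int"
  proof -
    have "unimodular_columns E R G"
      using that(1) totally_unimodular_imp_unimodular_columns[OF \<open>finite E\<close>]
        vertex_edge_matrix_totally_unimodular[of D R G]
        cycle_edge_matrix_imp_unimodular_columns[of D R G] by blast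
    from sum_flow_pairs_eq_rank_poly[OF module_zsmul \<open>finite E\<close> this that(2,3) nz]
    show ?thesis .
  qed
  have **: "Sum_any (\<lambda>k::int. of_nat (card (flow_pairs ((*s) :: 'k \<Rightarrow> 'k ^ 'd \<Rightarrow> 'k ^ 'd) E R G k)) * X powi k) =
      (2 - X - inverse X) ^ r * (X - 2 + inverse X + of_nat q) ^ (card E - r) *
      rank_poly E (col_rank R G)
        (of_nat q * (X - 2 + inverse X + of_nat q) / (2 - X - inverse X))
        ((2 - X - inverse X) / (X - 2 + inverse X + of_nat q))"
    if "CARD('k) = p ^ s" "q = p ^ (s * CARD('d))" "r = col_rank R G E"
    for G :: "'m \<Rightarrow> 'e \<Rightarrow> 'k" and p s :: nat
  proof -
    have "q = CARD('k ^ 'd)" using that(1,2) by (simp add: power_mult)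
    from sum_flow_pairs_eq_rank_poly[OF vec.module_axioms \<open>finite E\<close>
        unimodular_columns_field[OF \<open>finite E\<close>] this that(3) nz]
    show ?thesis .
  qed
  show ?thesis
  proof (intro conjI allI impI, goal_cases)
    case (1 D G)
    then show ?case by (elim conjE) (rule *)
  next
    case (2 G p s)
    then show ?case by (elim conjE) (rule **)
  qed
qed

end
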